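(* There exists a recursive sequence $(X_{k,l}\subseteq Y_{k,l})_{k,l\in\omega}$ of 3-unblockable extensions, with each $X_{k,l}$ having size $k$, and such that for each $k$ the extensions $X_{k,l}\subseteq Y_{k,l}$ ($l\in\omega$) are pairwise non-isomorphic. Further, if $\mu$ is 3-permissive, then $Y_{k,l}\in\mathcal C_\mu$ for every $k,l$.
   Context: Let $\mathcal L$ be a relational language whose symbols are indexed by a (finite or infinite) initial segment of $\omega$; all relations are symmetric and hold only of tuples of distinct elements. Assume $\mathcal L$ contains a ternary relation symbol $R$, and that the structure consisting of three elements with a single $R$-edge is in $\mathcal C_\mu$ for the $\mu$ considered. Subsets are regarded as induced substructures. For a finite structure $A$, $\delta(A)=|A|-\sum_{Q\in\mathcal L}\#Q(A)$, where $\#Q(A)$ is the number of occurrences of $Q$ on $A$ (up to permutation of the tuple). For finite $A,B\subseteq C$: $\delta(B/A)=\delta(A\cup B)-\delta(A)$; $\delta(A,C)=\inf\{\delta(D)\mid A\subseteq D\subseteq C \text{ finite}\}$; $A\le C$ means $\delta(A)=\delta(A,C)$. $B$ is simply algebraic over $A$ if $A\cap B=\emptyset$, $A\le A\cup B$, $\delta(B/A)=0$ and no proper nonempty $B'\subset B$ has $\delta(B'/A)=0$; minimally simply algebraic if moreover $A$ is minimal such that $B$ is simply algebraic over $A$. If $A\subseteq B$ and $B\setminus A$ is minimally simply algebraic over $A$, then $A\subseteq B$ (or $B/A$) is a minimally simply algebraic extension. $\mathcal C_0$ is the class of structures all of whose finite subsets have $\delta\ge0$. $B_1\oplus_A B_2$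 denotes the free join over $A=B_1\cap B_2$: the structure on $B_1\cup B_2$ with only the relations of $B_1$ and of $B_2$. $\mathrm{tp}_{r.q.f.}(B/A)$ is the set of (positive) atomic relations holding on tuples from $A\cup B$ not entirely contained in $A$. $B/A$ is of the form of $Y/X$ if, for suitable enumerations, $\mathrm{tp}_{q.f.}(A)=\mathrm{tp}_{q.f.}(X)$ and $\mathrm{tp}_{r.q.f.}(B/A)\supseteq\mathrm{tp}_{r.q.f.}(Y/X)$. $\mu(A,B,m)$ denotes an isomorphism-invariant function of minimally simply algebraic extensions $A\subset B$ and $m\in\omega\cup\{\infty\}$ with values in $\omega$ such that $\mu(A,B,m)\ge\delta(A)$; for every relative quantifier-free type $\Psi$ of a minimally simply algebraic extension there is a finite $\mathcal L_0\subseteq\mathcal L$ such that $\mathrm{tp}_{q.f.}(A)\vert\mathcal L_0=\mathrm{tp}_{q.f.}(A')\vert\mathcal L_0$ and $\mathrm{tp}_{r.q.f.}(B/A)=\mathrm{tp}_{r.q.f.}(B'/A')=\Psi$ imply $\mu(A,B,m)=\mu(A',B',m)$; and $\lim_{m\to\infty}\mu(A,B,m)=\mu(A,B,\infty)$. (Also write $\mu(A,B,m)$ for $\mu(A,A\cup B,m)$ when $B$ is disjoint from $A$.) $g_C(A)$ is the least $m$ such that some $X$ with $A\subseteq X\subseteq C$, $|X|\le|A|+m$, has $\delta(X)<\delta(A)$ with $\delta$ computed using only the first $m$ relations of $\mathcal L$; $g_C(A)=\infty$ if there is none. $\mathcal C_\mu$ is the class of finite $C\in\mathcal C_0$ such that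 whenever $A,B^1,\dots,B^r\subseteq C$ are disjoint with each $B^i/A$ of the form of a minimally simply algebraic $Y/X$, then $r\le\mu(X,Y,g_C(A))$. $\mu$ is $k$-permissive if $\mu(A,B,m)\ge k$ for all minimally simply algebraic $B$ over $A$ and all $m\in\omega\cup\{\infty\}$. A minimally simply algebraic extension $X\subseteq Y$ is $k$-unblockable if for any $k$-permissive $\mu$, if $Y\in\mathcal C_\mu$ then for any $Z\in\mathcal C_\mu$ with $X\subseteq Z$, either $Y\oplus_XZ\in\mathcal C_\mu$ or $Z$ already contains $\mu(X,Y,g_Z(X))$ disjoint extensions of the form of $Y/X$ over $X$. *)

theory Defs
  imports Complex_Main "HOL-Library.Extended_Nat" "HOL-Library.Nat_Bijection"
    "HOL-Library.Disjoint_Sets"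
begin

section \<open>Languages and structures\<close>

record language =
  symbols :: "nat set"
  arity :: "nat \<Rightarrow> nat"

definition wf_language :: "language \<Rightarrow> bool" where
  "wf_language L \<longleftrightarrow>
     (\<forall>i\<in>symbols L. \<forall>j<i. j \<in> symbols L) \<and> (\<forall>i\<in>symbols L. 0 < arity L i)"

text \<open>
  Relations are symmetric and hold only of tuples of distinct elements, so the interpretation of
  a symbol is a set of hyperedges: \<open>Q\<close> holds of a tuple iff the tuple is injective and
  its underlying set belongs to \<open>rels M Q\<close>. As every notion below concerns finite
  structures up to isomorphism, vertices are natural numbers.
\<close>

record struct =
  verts :: "nat set"
  rels :: "nat \<Rightarrow> nat set set"

definition occurrences :: "struct \<Rightarrow> nat \<Rightarrow> nat set \<Rightarrow> nat set set" where
  "occurrences M Q A = {e \<in> rels M Q. e \<subseteq> A}"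

text \<open>
  The last conjunct makes \<open>\<delta>\<close> of a finite set an integer. A finite set carrying infinitely
  many relations (possible in an infinite language) would have \<open>\<delta> = - \<infinity>\<close>; it could
  neither lie in \<open>C0\<close> nor be involved in a simply algebraic extension.
\<close>

definition wf_struct :: "language \<Rightarrow> struct \<Rightarrow> bool" where
  "wf_struct L M \<longleftrightarrow>
     (\<forall>Q. \<forall>e\<in>rels M Q. Q \<in> symbols L \<and> e \<subseteq> verts M \<and> finite e \<and> card e = arity L Q) \<and>
     (\<forall>A\<subseteq>verts M. finite A \<longrightarrow> finite (SIGMA Q:symbols L. occurrences M Q A))"

section \<open>Predimension\<close>

text \<open>
  \<open>delta S M A\<close> uses only the relation symbols in \<open>S\<close>; the cardinality of the disjoint
  sum is \<open>\<Sum>\<^sub>Q #Q(A)\<close>, which remains meaningful for infinite \<open>S\<close>.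
\<close>

definition delta :: "nat set \<Rightarrow> struct \<Rightarrow> nat set \<Rightarrow> int" where
  "delta S M A = int (card A) - int (card (SIGMA Q:S. occurrences M Q A))"

definition delta_over :: "nat set \<Rightarrow> struct \<Rightarrow> nat set \<Rightarrow> nat set \<Rightarrow> int" where
  "delta_over S M B A = delta S M (A \<union> B) - delta S M A"

definition delta_in :: "nat set \<Rightarrow> struct \<Rightarrow> nat set \<Rightarrow> nat set \<Rightarrow> int" where
  "delta_in S M A C = Inf {delta S M D | D. A \<subseteq> D \<and> D \<subseteq> C \<and> finite D}"

definition strong :: "nat set \<Rightarrow> struct \<Rightarrow> nat set \<Rightarrow> nat set \<Rightarrow> bool" where
  "strong S M A C \<longleftrightarrow> A \<subseteq> C \<and> delta S M A = delta_in S M A C"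

definition C0 :: "language \<Rightarrow> struct set" where
  "C0 L = {M. wf_struct L M \<and> (\<forall>A\<subseteq>verts M. finite A \<longrightarrow> 0 \<le> delta (symbols L) M A)}"

section \<open>Minimally simply algebraic extensions\<close>

text \<open>
  \<open>B\<close> is required to be nonempty: otherwise the empty set would be simply algebraic over every
  set, and unboundedly many (equal, disjoint) copies of it would occur in every structure.
\<close>

definition simply_algebraic :: "language \<Rightarrow> struct \<Rightarrow> nat set \<Rightarrow> nat set \<Rightarrow> bool" where
  "simply_algebraic L M B A \<longleftrightarrow>
     finite A \<and> finite B \<and> A \<subseteq> verts M \<and> B \<subseteq> verts M \<and> B \<noteq> {} \<and>
     A \<inter> B = {} \<and> strong (symbols L) M A (A \<union> B) \<and> delta_over (symbols L) M B A = 0 \<and>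
     \<not> (\<exists>B'. B' \<subset> B \<and> B' \<noteq> {} \<and> delta_over (symbols L) M B' A = 0)"

definition min_simply_algebraic :: "language \<Rightarrow> struct \<Rightarrow> nat set \<Rightarrow> nat set \<Rightarrow> bool" where
  "min_simply_algebraic L M B A \<longleftrightarrow>
     simply_algebraic L M B A \<and> \<not> (\<exists>A'. A' \<subset> A \<and> simply_algebraic L M B A')"

text \<open>
  An extension \<open>X \<subseteq> Y\<close> is given by the structure \<open>Y\<close> and the vertex set
  \<open>X\<close> of its induced substructure.
\<close>

definition msa_ext :: "language \<Rightarrow> nat set \<Rightarrow> struct \<Rightarrow> bool" where
  "msa_ext L X Y \<longleftrightarrow>
     wf_struct L Y \<and> X \<subseteq> verts Y \<and> min_simply_algebraic L Y (verts Y - X) X"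

definition ext_iso :: "language \<Rightarrow> nat set \<Rightarrow> struct \<Rightarrow> nat set \<Rightarrow> struct \<Rightarrow> bool" where
  "ext_iso L X Y X' Y' \<longleftrightarrow>
     (\<exists>f. bij_betw f (verts Y) (verts Y') \<and> f ` X = X' \<and>
        (\<forall>Q\<in>symbols L. \<forall>e\<subseteq>verts Y. e \<in> rels Y Q \<longleftrightarrow> f ` e \<in> rels Y' Q))"

section \<open>Quantifier-free types\<close>

definition enumerates :: "nat list \<Rightarrow> nat set \<Rightarrow> bool" where
  "enumerates xs A \<longleftrightarrow> distinct xs \<and> set xs = A"

text \<open>
  The pair \<open>(Q, I)\<close> stands for the atomic formula \<open>Q(x\<^sub>i : i \<in> I)\<close>; by symmetry
  the order of the variables is irrelevant. For distinct tuples the positive part listed here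
  determines the full quantifier-free type. \<open>S\<close> is the set of symbols to which the type is
  restricted.
\<close>

definition qf_type :: "nat set \<Rightarrow> struct \<Rightarrow> nat list \<Rightarrow> (nat \<times> nat set) set" where
  "qf_type S M a = {(Q, I). Q \<in> S \<and> I \<subseteq> {..<length a} \<and> (!) a ` I \<in> rels M Q}"

definition rqf_type :: "nat set \<Rightarrow> struct \<Rightarrow> nat list \<Rightarrow> nat list \<Rightarrow> (nat \<times> nat set) set" where
  "rqf_type S M a b = {(Q, I). (Q, I) \<in> qf_type S M (a @ b) \<and> \<not> I \<subseteq> {..<length a}}"

definition of_form ::
    "language \<Rightarrow> struct \<Rightarrow> nat set \<Rightarrow> nat set \<Rightarrow> nat set \<Rightarrow> struct \<Rightarrow> bool" where
  "of_form L M A B X Y \<longleftrightarrow>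
     (\<exists>a b x y. enumerates a A \<and> enumerates b B \<and> enumerates x X \<and> enumerates y (verts Y - X) \<and>
        length a = length x \<and> length b = length y \<and>
        qf_type (symbols L) M a = qf_type (symbols L) Y x \<and>
        rqf_type (symbols L) Y x y \<subseteq> rqf_type (symbols L) M a b)"

section \<open>The classes determined by a multiplicity function\<close>

type_synonym mult_fun = "nat set \<Rightarrow> struct \<Rightarrow> enat \<Rightarrow> nat"

definition drops_within :: "language \<Rightarrow> struct \<Rightarrow> nat set \<Rightarrow> nat \<Rightarrow> bool" where
  "drops_within L C A m \<longleftrightarrow>
     (\<exists>X. A \<subseteq> X \<and> X \<subseteq> verts C \<and> finite X \<and> card X \<le> card A + m \<and>
        delta (symbols L \<inter> {..<m}) C X < delta (symbols L \<inter> {..<m}) C A)"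

definition g :: "language \<Rightarrow> struct \<Rightarrow> nat set \<Rightarrow> enat" where
  "g L C A = (if \<exists>m. drops_within L C A m then enat (LEAST m. drops_within L C A m) else \<infinity>)"

definition C_mu :: "language \<Rightarrow> mult_fun \<Rightarrow> struct set" where
  "C_mu L \<mu> = {C \<in> C0 L. finite (verts C) \<and>
     (\<forall>A B (r::nat) X Y.
        A \<subseteq> verts C \<and> (\<forall>i<r. B i \<subseteq> verts C \<and> A \<inter> B i = {}) \<and> disjoint_family_on B {..<r} \<and>
        msa_ext L X Y \<and> (\<forall>i<r. of_form L C A (B i) X Y)
        \<longrightarrow> r \<le> \<mu> X Y (g L C A))}"

definition edge_struct :: "nat \<Rightarrow> struct" where
  "edge_struct R = \<lparr>verts = {0, 1, 2}, rels = (\<lambda>Q. if Q = R then {{0, 1, 2}} else {})\<rparr>"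

text \<open>
  The conjuncts are: invariance under isomorphism, the lower bound \<open>\<delta>(A)\<close>, dependence on
  \<open>tp(A)\<close> only through a finite sublanguage once the relative type is fixed (to that of the
  enumerated extension \<open>X\<^sub>0 \<subseteq> Y\<^sub>0\<close>), continuity at \<open>\<infinity>\<close>, and the
  standing assumption that the single \<open>R\<close>-edge lies in the class. Values of \<open>\<mu>\<close>
  at arguments that are not minimally simply algebraic extensions are irrelevant.
\<close>

definition mult_function :: "language \<Rightarrow> nat \<Rightarrow> mult_fun \<Rightarrow> bool" where
  "mult_function L R \<mu> \<longleftrightarrow>
     (\<forall>X Y X' Y' m. msa_ext L X Y \<and> msa_ext L X' Y' \<and> ext_iso L X Y X' Y'
        \<longrightarrow> \<mu> X Y m = \<mu> X' Y' m) \<and>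
     (\<forall>X Y m. msa_ext L X Y \<longrightarrow> delta (symbols L) Y X \<le> int (\<mu> X Y m)) \<and>
     (\<forall>X\<^sub>0 Y\<^sub>0 x\<^sub>0 y\<^sub>0.
        msa_ext L X\<^sub>0 Y\<^sub>0 \<and> enumerates x\<^sub>0 X\<^sub>0 \<and> enumerates y\<^sub>0 (verts Y\<^sub>0 - X\<^sub>0) \<longrightarrow>
        (\<exists>L\<^sub>0\<subseteq>symbols L. finite L\<^sub>0 \<and>
          (\<forall>X Y x y X' Y' x' y'.
             msa_ext L X Y \<and> enumerates x X \<and> enumerates y (verts Y - X) \<and>
             msa_ext L X' Y' \<and> enumerates x' X' \<and> enumerates y' (verts Y' - X') \<and>
             length x = length x\<^sub>0 \<and> length x' = length x\<^sub>0 \<and>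
             length y = length y\<^sub>0 \<and> length y' = length y\<^sub>0 \<and>
             qf_type L\<^sub>0 Y x = qf_type L\<^sub>0 Y' x' \<and>
             rqf_type (symbols L) Y x y = rqf_type (symbols L) Y\<^sub>0 x\<^sub>0 y\<^sub>0 \<and>
             rqf_type (symbols L) Y' x' y' = rqf_type (symbols L) Y\<^sub>0 x\<^sub>0 y\<^sub>0
             \<longrightarrow> (\<forall>m. \<mu> X Y m = \<mu> X' Y' m)))) \<and>
     (\<forall>X Y. msa_ext L X Y \<longrightarrow> (\<lambda>m. \<mu> X Y (enat m)) \<longlonglongrightarrow> \<mu> X Y \<infinity>) \<and>
     edge_struct R \<in> C_mu L \<mu>"

definition permissive :: "language \<Rightarrow> nat \<Rightarrow> mult_fun \<Rightarrow> bool" where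
  "permissive L k \<mu> \<longleftrightarrow> (\<forall>X Y m. msa_ext L X Y \<longrightarrow> k \<le> \<mu> X Y m)"

section \<open>Unblockable extensions\<close>

definition free_join :: "struct \<Rightarrow> struct \<Rightarrow> struct" where
  "free_join M N = \<lparr>verts = verts M \<union> verts N, rels = (\<lambda>Q. rels M Q \<union> rels N Q)\<rparr>"

definition induced_eq :: "language \<Rightarrow> struct \<Rightarrow> struct \<Rightarrow> nat set \<Rightarrow> bool" where
  "induced_eq L M N X \<longleftrightarrow> (\<forall>Q\<in>symbols L. occurrences M Q X = occurrences N Q X)"

definition has_disjoint_copies ::
    "language \<Rightarrow> struct \<Rightarrow> nat \<Rightarrow> nat set \<Rightarrow> struct \<Rightarrow> bool" where
  "has_disjoint_copies L Z r X Y \<longleftrightarrow>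
     (\<exists>B. disjoint_family_on B {..<r} \<and>
        (\<forall>i<r. B i \<subseteq> verts Z \<and> X \<inter> B i = {} \<and> of_form L Z X (B i) X Y))"

text \<open>
  The condition \<open>verts Y \<inter> verts Z = X\<close> says that \<open>Y\<close> and \<open>Z\<close> are in the position
  in which their free join over \<open>X\<close> is defined; any \<open>Z\<close> extending \<open>X\<close> has an
  isomorphic copy over \<open>X\<close> satisfying it.
\<close>

definition unblockable :: "language \<Rightarrow> nat \<Rightarrow> nat \<Rightarrow> nat set \<Rightarrow> struct \<Rightarrow> bool" where
  "unblockable L R k X Y \<longleftrightarrow>
     msa_ext L X Y \<and>
     (\<forall>\<mu>. mult_function L R \<mu> \<and> permissive L k \<mu> \<and> Y \<in> C_mu L \<mu> \<longrightarrow>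
        (\<forall>Z\<in>C_mu L \<mu>. verts Y \<inter> verts Z = X \<and> induced_eq L Y Z X \<longrightarrow>
           free_join Y Z \<in> C_mu L \<mu> \<or> has_disjoint_copies L Z (\<mu> X Y (g L Z X)) X Y))"

section \<open>Recursive sequences\<close>

text \<open>
  \<open>recfn n f\<close>: restricted to lists of length \<open>n\<close>, \<open>f\<close> is a total recursive
  \<open>n\<close>-ary function (Kleene's schemes, with minimization applied to regular functions only).
\<close>

inductive recfn :: "nat \<Rightarrow> (nat list \<Rightarrow> nat) \<Rightarrow> bool" where
  zero: "recfn n (\<lambda>xs. 0)"
| succ: "recfn 1 (\<lambda>xs. Suc (xs ! 0))"
| proj: "i < n \<Longrightarrow> recfn n (\<lambda>xs. xs ! i)"
| comp: "\<lbrakk>recfn (length gs) f; \<And>h. h \<in> set gs \<Longrightarrow> recfn n h\<rbrakk>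
    \<Longrightarrow> recfn n (\<lambda>xs. f (map (\<lambda>h. h xs) gs))"
| prec: "\<lbrakk>recfn n f; recfn (Suc (Suc n)) h\<rbrakk>
    \<Longrightarrow> recfn (Suc n) (\<lambda>xs. rec_nat (f (tl xs)) (\<lambda>m r. h (m # r # tl xs)) (hd xs))"
| minim: "\<lbrakk>recfn (Suc n) f; \<And>xs. length xs = n \<Longrightarrow> \<exists>y. f (y # xs) = 0\<rbrakk>
    \<Longrightarrow> recfn n (\<lambda>xs. LEAST y. f (y # xs) = 0)"

text \<open>Canonical (strong) index of a finite extension.\<close>

definition ext_code :: "nat set \<Rightarrow> struct \<Rightarrow> nat" where
  "ext_code X Y = prod_encode (set_encode X, prod_encode (set_encode (verts Y),
     set_encode {prod_encode (Q, set_encode e) | Q e. e \<in> rels Y Q}))"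

definition recursive_sequence :: "(nat \<Rightarrow> nat \<Rightarrow> nat set) \<Rightarrow> (nat \<Rightarrow> nat \<Rightarrow> struct) \<Rightarrow> bool" where
  "recursive_sequence X Y \<longleftrightarrow> (\<exists>f. recfn 2 f \<and> (\<forall>k l. f [k, l] = ext_code (X k l) (Y k l)))"

end

theory Submission imports Defs begin

text \<open>
  The single idea is that bounded degree makes an extension unblockable. Let \<open>X \<subseteq> Y\<close> be minimally
  simply algebraic, with every vertex of \<open>W = verts Y - X\<close> on at most \<open>k\<close> edges, let \<open>\<mu>\<close> be
  \<open>k\<close>-permissive, and let \<open>C\<close> be the free join of \<open>Y\<close> with some \<open>Z\<close> in the class. Consider \<open>r > k\<close>
  disjoint copies of an extension \<open>Y'/X'\<close> over \<open>A\<close> in \<open>C\<close>. Minimality of \<open>X'\<close> gives every vertex of \<open>A\<close>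
  an edge to each copy, so a vertex of \<open>A\<close> in \<open>W\<close> would have degree above \<open>k\<close>; thus \<open>A\<close> lies in \<open>Z\<close>
  (\<open>disjoint_copies_le_degree\<close>). A copy meeting \<open>W\<close> is then equal to \<open>W\<close> and isomorphic to \<open>Y/X\<close>, by a
  comparison of edge counts (\<open>copy_meeting_extension\<close>). So either all copies lie in \<open>Z\<close>, where
  their number is bounded by the same value of \<open>\<mu>\<close>, because \<open>g\<close> is the same in \<open>Z\<close> and in \<open>C\<close>
  (\<open>g_join\<close>), or all but one are copies of \<open>Y/X\<close> over \<open>X\<close> in \<open>Z\<close>. If too many copies make \<open>C\<close> leave
  the class, \<open>Z\<close> therefore has the required number of copies of \<open>Y/X\<close>
  (\<open>join_in_C_mu_or_copies\<close>). Membership of \<open>Y\<close> itself in the class is the case where \<open>Z\<close> is \<open>X\<close>, if \<open>X\<close>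
  carries no relations.

  It remains to find extensions of degree at most \<open>3\<close> over a relation-free base of size \<open>k\<close>. On a cycle
  of \<open>n\<close> new vertices the \<open>i\<close>-th edge contains \<open>i\<close>, \<open>i + 1\<close> and a third vertex, which is a base vertex
  for \<open>i < k\<close> and \<open>i + 2\<close> otherwise. There are as many edges as new vertices, a proper part
  of the cycle contains fewer edges than vertices, and a new vertex lies on at most three edges. The
  lengths \<open>n = k + l + 5\<close> distinguish the extensions for fixed \<open>k\<close>, and their codes are given by
  bounded sums of elementary arithmetic functions.
\<close>

section \<open>Relative edges\<close>

text \<open>
  Relative to a base \<open>A\<close>, a set \<open>B\<close> disjoint from it costs one vertex per element and gains
  one per edge counted here: \<open>\<delta>(B/A)\<close> is \<open>card B\<close> minus the number of these edges. Every
  argument below is a count of such sets.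
\<close>

definition new_edges :: "nat set \<Rightarrow> struct \<Rightarrow> nat set \<Rightarrow> nat set \<Rightarrow> (nat \<times> nat set) set" where
  "new_edges S M B A = (SIGMA Q:S. {e \<in> rels M Q. e \<subseteq> A \<union> B \<and> \<not> e \<subseteq> A})"

lemma mem_new_edges:
  "(Q, e) \<in> new_edges S M B A \<longleftrightarrow> Q \<in> S \<and> e \<in> rels M Q \<and> e \<subseteq> A \<union> B \<and> \<not> e \<subseteq> A"
  by (auto simp: new_edges_def)

lemma new_edges_mono:
  assumes "A \<subseteq> A'" "B \<subseteq> B'" "A' \<inter> B = {}" "S \<subseteq> S'"
  shows "new_edges S M B A \<subseteq> new_edges S' M B' A'"
  using assms unfolding new_edges_def by blast

lemma wf_struct_relsD:
  assumes "wf_struct L M" "e \<in> rels M Q"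
  shows "Q \<in> symbols L" "e \<subseteq> verts M" "finite e" "card e = arity L Q"
  using assms unfolding wf_struct_def by blast+

lemma finite_occurrences:
  assumes "wf_struct L M" "finite A" "A \<subseteq> verts M" "S \<subseteq> symbols L"
  shows "finite (SIGMA Q:S. occurrences M Q A)"
proof (rule finite_subset)
  show "(SIGMA Q:S. occurrences M Q A) \<subseteq> (SIGMA Q:symbols L. occurrences M Q A)"
    using assms(4) by auto
  show "finite (SIGMA Q:symbols L. occurrences M Q A)"
    using assms(1-3) unfolding wf_struct_def by blast
qed

lemma finite_new_edges:
  assumes "wf_struct L M" "finite A" "finite B" "A \<subseteq> verts M" "B \<subseteq> verts M" "S \<subseteq> symbols L"
  shows "finite (new_edges S M B A)"
proof (rule finite_subset)
  show "new_edges S M B A \<subseteq> (SIGMA Q:S. occurrences M Q (A \<union> B))"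
    by (auto simp: new_edges_def occurrences_def)
  show "finite (SIGMA Q:S. occurrences M Q (A \<union> B))"
    using assms by (intro finite_occurrences[of L]) auto
qed

lemma delta_Un:
  assumes "wf_struct L M" "finite A" "finite B" "A \<subseteq> verts M" "B \<subseteq> verts M" "S \<subseteq> symbols L"
    and "A \<inter> B = {}"
  shows "delta S M (A \<union> B) = delta S M A + int (card B) - int (card (new_edges S M B A))"
proof -
  have eq: "(SIGMA Q:S. occurrences M Q (A \<union> B)) = (SIGMA Q:S. occurrences M Q A) \<union> new_edges S M B A"
    by (auto simp: new_edges_def occurrences_def)
  have "card (SIGMA Q:S. occurrences M Q (A \<union> B))
      = card (SIGMA Q:S. occurrences M Q A) + card (new_edges S M B A)"
    unfolding eq
    by (rule card_Un_disjoint) 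
       (use finite_occurrences[OF assms(1,2,4,6)] finite_new_edges[OF assms(1-6)] in
         \<open>auto simp: mem_new_edges occurrences_def\<close>)
  moreover have "card (A \<union> B) = card A + card B"
    using assms by (intro card_Un_disjoint) auto
  ultimately show ?thesis unfolding delta_def by simp
qed

lemma strong_iff:
  assumes "finite C"
  shows "strong S M A C \<longleftrightarrow> A \<subseteq> C \<and> (\<forall>D. A \<subseteq> D \<and> D \<subseteq> C \<longrightarrow> delta S M A \<le> delta S M D)"
proof (cases "A \<subseteq> C")
  case True
  let ?V = "{delta S M D | D. A \<subseteq> D \<and> D \<subseteq> C \<and> finite D}"
  have "?V \<subseteq> delta S M ` Pow C" by auto
  hence fin: "finite ?V" using assms by (meson finite_Pow_iff finite_imageI finite_subset)
  have mem: "delta S M A \<in> ?V" using True assms finite_subset by blast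
  have Inf: "Inf ?V = Min ?V" using fin mem by (intro cInf_eq_Min) auto
  show ?thesis
  proof
    assume "strong S M A C"
    hence "delta S M A = Min ?V" using Inf by (simp add: strong_def delta_in_def)
    thus "A \<subseteq> C \<and> (\<forall>D. A \<subseteq> D \<and> D \<subseteq> C \<longrightarrow> delta S M A \<le> delta S M D)"
      using True fin finite_subset[OF _ assms] by (auto intro!: Min_le)
  next
    assume "A \<subseteq> C \<and> (\<forall>D. A \<subseteq> D \<and> D \<subseteq> C \<longrightarrow> delta S M A \<le> delta S M D)"
    hence "Min ?V = delta S M A" using fin mem by (auto intro!: Min_eqI)
    thus "strong S M A C" using True Inf by (simp add: strong_def delta_in_def)
  qed
qed (simp add: strong_def)

text \<open>
  Strength of \<open>A\<close> in \<open>A \<union> B\<close> and the absence of intermediate sets of relative predimension \<open>0\<close>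
  combine into one strict bound for the proper nonempty parts of \<open>B\<close>.
\<close>

lemma simply_algebraic_iff:
  assumes wf: "wf_struct L M"
  shows "simply_algebraic L M B A \<longleftrightarrow>
    finite A \<and> finite B \<and> A \<subseteq> verts M \<and> B \<subseteq> verts M \<and> B \<noteq> {} \<and> A \<inter> B = {} \<and>
    card (new_edges (symbols L) M B A) = card B \<and>
    (\<forall>U. U \<subset> B \<and> U \<noteq> {} \<longrightarrow> card (new_edges (symbols L) M U A) < card U)"
proof (cases "finite A \<and> finite B \<and> A \<subseteq> verts M \<and> B \<subseteq> verts M \<and> B \<noteq> {} \<and> A \<inter> B = {}")
  case True
  define d where "d U = int (card U) - int (card (new_edges (symbols L) M U A))" for U
  have Un: "delta (symbols L) M (A \<union> U) = delta (symbols L) M A + d U" if "U \<subseteq> B" for U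
    unfolding d_def by (subst delta_Un[OF wf]) (use that True in \<open>auto intro: finite_subset\<close>)
  have over: "delta_over (symbols L) M U A = d U" if "U \<subseteq> B" for U
    using Un[OF that] by (simp add: delta_over_def)
  have "d {} = 0" by (simp add: d_def new_edges_def)
  have "strong (symbols L) M A (A \<union> B) \<longleftrightarrow>
      (\<forall>D. A \<subseteq> D \<and> D \<subseteq> A \<union> B \<longrightarrow> delta (symbols L) M A \<le> delta (symbols L) M D)"
    by (subst strong_iff) (use True in auto)
  also have "\<dots> \<longleftrightarrow> (\<forall>U\<subseteq>B. delta (symbols L) M A \<le> delta (symbols L) M (A \<union> U))"
  proof (intro iffI allI impI)
    fix D
    assume *: "\<forall>U\<subseteq>B. delta (symbols L) M A \<le> delta (symbols L) M (A \<union> U)"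
      and D: "A \<subseteq> D \<and> D \<subseteq> A \<union> B"
    hence "A \<union> (D - A) = D" "D - A \<subseteq> B" by auto
    thus "delta (symbols L) M A \<le> delta (symbols L) M D" using * by metis
  qed auto
  also have "\<dots> \<longleftrightarrow> (\<forall>U\<subseteq>B. 0 \<le> d U)" using Un by simp
  finally have strong: "strong (symbols L) M A (A \<union> B) \<longleftrightarrow> (\<forall>U\<subseteq>B. 0 \<le> d U)" .
  have proper: "(\<exists>U. U \<subset> B \<and> U \<noteq> {} \<and> delta_over (symbols L) M U A = 0) \<longleftrightarrow>
      (\<exists>U. U \<subset> B \<and> U \<noteq> {} \<and> d U = 0)"
    by (intro iff_exI conj_cong refl) (simp add: over psubset_imp_subset)
  have "simply_algebraic L M B A \<longleftrightarrow>
      (\<forall>U\<subseteq>B. 0 \<le> d U) \<and> d B = 0 \<and> (\<forall>U. U \<subset> B \<and> U \<noteq> {} \<longrightarrow> d U \<noteq> 0)"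
    unfolding simply_algebraic_def strong over[OF order_refl] proper using True by blast
  also have "\<dots> \<longleftrightarrow> d B = 0 \<and> (\<forall>U. U \<subset> B \<and> U \<noteq> {} \<longrightarrow> 0 < d U)" (is "?l \<longleftrightarrow> ?r")
  proof
    assume l: ?l
    have "0 < d U" if "U \<subset> B" "U \<noteq> {}" for U
      using l that psubset_imp_subset[OF that(1)] by (metis order_le_less)
    with l show ?r by blast
  next
    assume r: ?r
    have "0 \<le> d U" if "U \<subseteq> B" for U
      using r that \<open>d {} = 0\<close> by (cases "U = {} \<or> U = B") (auto simp: psubset_eq less_imp_le)
    moreover have "d U \<noteq> 0" if "U \<subset> B" "U \<noteq> {}" for U
      using r that by (metis less_irrefl)
    ultimately show ?l using r by blast
  qed
  also have "\<dots> \<longleftrightarrow> card (new_edges (symbols L) M B A) = card B \<and>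
     (\<forall>U. U \<subset> B \<and> U \<noteq> {} \<longrightarrow> card (new_edges (symbols L) M U A) < card U)"
    by (auto simp: d_def)
  finally show ?thesis using True by blast
qed (auto simp: simply_algebraic_def)

text \<open>
  A base vertex on no edge to \<open>B\<close> can be dropped without changing any of the relevant edge counts.
  Conversely, dropping a vertex that lies on such an edge loses the edge, so that \<open>\<delta>(B/A')\<close>
  becomes positive.
\<close>

lemma min_simply_algebraic_iff:
  assumes wf: "wf_struct L M"
  shows "min_simply_algebraic L M B A \<longleftrightarrow> simply_algebraic L M B A \<and>
    (\<forall>x\<in>A. \<exists>Q e. (Q, e) \<in> new_edges (symbols L) M B A \<and> x \<in> e)"
proof (intro iffI conjI ballI)
  assume msa: "min_simply_algebraic L M B A"
  show sa: "simply_algebraic L M B A" using msa by (simp add: min_simply_algebraic_def)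
  fix x assume x: "x \<in> A"
  show "\<exists>Q e. (Q, e) \<in> new_edges (symbols L) M B A \<and> x \<in> e"
  proof (rule ccontr)
    assume no: "\<not> ?thesis"
    have "new_edges (symbols L) M U (A - {x}) = new_edges (symbols L) M U A" if "U \<subseteq> B" for U
    proof -
      have "A \<inter> B = {}" using sa by (simp add: simply_algebraic_def)
      hence "x \<notin> U" "x \<notin> B" using x that by blast+
      show ?thesis
      proof (intro set_eqI iffI; clarify)
        fix Q e assume "(Q, e) \<in> new_edges (symbols L) M U (A - {x})"
        thus "(Q, e) \<in> new_edges (symbols L) M U A" using \<open>x \<notin> U\<close> by (auto simp: mem_new_edges)
      next
        fix Q e assume e: "(Q, e) \<in> new_edges (symbols L) M U A"
        hence "(Q, e) \<in> new_edges (symbols L) M B A" using that by (auto simp: mem_new_edges)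
        hence "x \<notin> e" using no by blast
        thus "(Q, e) \<in> new_edges (symbols L) M U (A - {x})" using e by (auto simp: mem_new_edges)
      qed
    qed
    hence "simply_algebraic L M B (A - {x})"
      using sa unfolding simply_algebraic_iff[OF wf] by (auto simp: psubset_eq)
    moreover have "A - {x} \<subset> A" using x by blast
    ultimately show False using msa by (auto simp: min_simply_algebraic_def)
  qed
next
  assume r: "simply_algebraic L M B A \<and>
    (\<forall>x\<in>A. \<exists>Q e. (Q, e) \<in> new_edges (symbols L) M B A \<and> x \<in> e)"
  hence sa: "simply_algebraic L M B A" by simp
  show "min_simply_algebraic L M B A" unfolding min_simply_algebraic_def
  proof (intro conjI notI sa; elim exE conjE)
    fix A' assume A': "A' \<subset> A" "simply_algebraic L M B A'"
    have disj: "A \<inter> B = {}" using sa by (simp add: simply_algebraic_def)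
    have "new_edges (symbols L) M B A' \<subseteq> new_edges (symbols L) M B A"
      using A'(1) disj by (intro new_edges_mono) auto
    moreover have "card (new_edges (symbols L) M B A') = card (new_edges (symbols L) M B A)"
      using A'(2) sa by (simp add: simply_algebraic_iff[OF wf])
    moreover have "finite (new_edges (symbols L) M B A)"
      using sa by (intro finite_new_edges[OF wf]) (auto simp: simply_algebraic_def)
    ultimately have eq: "new_edges (symbols L) M B A' = new_edges (symbols L) M B A"
      using card_subset_eq by blast
    obtain x where x: "x \<in> A" "x \<notin> A'" using A'(1) by blast
    then obtain Q e where "(Q, e) \<in> new_edges (symbols L) M B A" "x \<in> e" using r by blast
    hence "x \<in> A' \<union> B" using eq by (metis mem_new_edges subsetD)
    thus False using x disj by blast
  qed
qed

lemma msa_extD: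
  assumes "msa_ext L X Y"
  shows "wf_struct L Y" "X \<subseteq> verts Y" "finite (verts Y)"
    "card (new_edges (symbols L) Y (verts Y - X) X) = card (verts Y - X)"
    "\<And>U. U \<subseteq> verts Y - X \<Longrightarrow> card (new_edges (symbols L) Y U X) \<le> card U"
    "\<And>U. U \<subset> verts Y - X \<Longrightarrow> U \<noteq> {} \<Longrightarrow> card (new_edges (symbols L) Y U X) < card U"
    "\<And>x. x \<in> X \<Longrightarrow> \<exists>Q e. (Q, e) \<in> new_edges (symbols L) Y (verts Y - X) X \<and> x \<in> e"
    "verts Y - X \<noteq> {}"
proof -
  show wf: "wf_struct L Y" and XY: "X \<subseteq> verts Y"
    using assms by (auto simp: msa_ext_def)
  have sa: "simply_algebraic L Y (verts Y - X) X"
    and all: "\<forall>x\<in>X. \<exists>Q e. (Q, e) \<in> new_edges (symbols L) Y (verts Y - X) X \<and> x \<in> e"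
    using assms wf by (auto simp: msa_ext_def min_simply_algebraic_iff)
  show "\<exists>Q e. (Q, e) \<in> new_edges (symbols L) Y (verts Y - X) X \<and> x \<in> e" if "x \<in> X" for x
    using all that by blast
  note sa' = sa[unfolded simply_algebraic_iff[OF wf]]
  show "finite (verts Y)" using sa' by (meson finite_Diff2)
  show full: "card (new_edges (symbols L) Y (verts Y - X) X) = card (verts Y - X)"
    and less: "\<And>U. U \<subset> verts Y - X \<Longrightarrow> U \<noteq> {} \<Longrightarrow> card (new_edges (symbols L) Y U X) < card U"
    and "verts Y - X \<noteq> {}"
    using sa' by blast+
  show "card (new_edges (symbols L) Y U X) \<le> card U" if U: "U \<subseteq> verts Y - X" for U
  proof (cases "U = {} \<or> U = verts Y - X")
    case True thus ?thesis using full by (auto simp: new_edges_def)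
  next
    case False thus ?thesis using less[of U] U by fastforce
  qed
qed

section \<open>Copies of an extension as maps\<close>

text \<open>
  The enumerations in the definition of being of the form of \<open>Y/X\<close> serve only to match vertices;
  a map \<open>\<phi>\<close> does this directly. Inside the base relations are preserved and reflected, across
  it they are only preserved, since a copy may carry additional relations.
\<close>

definition copy_map :: "language \<Rightarrow> struct \<Rightarrow> nat set \<Rightarrow> nat set \<Rightarrow> nat set \<Rightarrow> struct \<Rightarrow> (nat \<Rightarrow> nat) \<Rightarrow> bool" where
  "copy_map L M A B X Y \<phi> \<longleftrightarrow> inj_on \<phi> (verts Y) \<and> \<phi> ` X = A \<and> \<phi> ` (verts Y - X) = B \<and>
     (\<forall>Q\<in>symbols L. \<forall>e\<subseteq>X. e \<in> rels Y Q \<longleftrightarrow> \<phi> ` e \<in> rels M Q) \<and>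
     (\<forall>Q\<in>symbols L. \<forall>e\<subseteq>verts Y. \<not> e \<subseteq> X \<longrightarrow> e \<in> rels Y Q \<longrightarrow> \<phi> ` e \<in> rels M Q)"

lemma copy_mapD:
  assumes "copy_map L M A B X Y \<phi>"
  shows "inj_on \<phi> (verts Y)" "\<phi> ` X = A" "\<phi> ` (verts Y - X) = B"
    "\<And>Q e. Q \<in> symbols L \<Longrightarrow> e \<subseteq> X \<Longrightarrow> e \<in> rels Y Q \<longleftrightarrow> \<phi> ` e \<in> rels M Q"
    "\<And>Q e. Q \<in> symbols L \<Longrightarrow> e \<subseteq> verts Y \<Longrightarrow> \<not> e \<subseteq> X \<Longrightarrow> e \<in> rels Y Q \<Longrightarrow> \<phi> ` e \<in> rels M Q"
  using assms by (simp_all add: copy_map_def)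

lemma subset_set_conv_index:
  assumes "e \<subseteq> set xs"
  obtains I where "I \<subseteq> {..<length xs}" "(!) xs ` I = e"
proof
  show "{i. i < length xs \<and> xs ! i \<in> e} \<subseteq> {..<length xs}" by auto
  show "(!) xs ` {i. i < length xs \<and> xs ! i \<in> e} = e"
    using assms by (auto simp: in_set_conv_nth image_iff) (metis in_set_conv_nth subsetD)
qed

lemma image_nth_map: "I \<subseteq> {..<length xs} \<Longrightarrow> (!) (map f xs) ` I = f ` ((!) xs ` I)"
  by (auto simp: image_image intro!: image_cong)

lemma image_nth_append1: "I \<subseteq> {..<length xs} \<Longrightarrow> (!) (xs @ ys) ` I = (!) xs ` I"
  by (intro image_cong) (auto simp: nth_append)

lemma of_form_iff_copy_map:
  assumes fin: "finite (verts Y)" and XY: "X \<subseteq> verts Y" and disj: "A \<inter> B = {}"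
  shows "of_form L M A B X Y \<longleftrightarrow> (\<exists>\<phi>. copy_map L M A B X Y \<phi>)"
proof
  assume "of_form L M A B X Y"
  then obtain a b x y where
    en: "distinct a" "set a = A" "distinct b" "set b = B" "distinct x" "set x = X"
      "distinct y" "set y = verts Y - X" and len: "length a = length x" "length b = length y"
    and qf: "qf_type (symbols L) M a = qf_type (symbols L) Y x"
    and rqf: "rqf_type (symbols L) Y x y \<subseteq> rqf_type (symbols L) M a b"
    unfolding of_form_def enumerates_def by metis
  let ?xy = "x @ y" and ?ab = "a @ b"
  have dxy: "distinct ?xy" and sxy: "set ?xy = verts Y" and dab: "distinct ?ab"
    using en XY disj by auto
  have len': "length ?ab = length ?xy" using len by simp
  define \<phi> where "\<phi> v = the (map_of (zip ?xy ?ab) v)" for v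
  have nth: "\<phi> (?xy ! i) = ?ab ! i" if "i < length ?xy" for i
    using map_of_zip_nth[OF len'[symmetric] dxy] that len' by (simp add: \<phi>_def)
  have m: "map \<phi> ?xy = ?ab" using nth len' by (metis map_nth nth_equalityI length_map nth_map)
  hence mx: "map \<phi> x = a" and my: "map \<phi> y = b" using len by auto
  have "copy_map L M A B X Y \<phi>" unfolding copy_map_def
  proof (intro conjI ballI allI impI)
    show "inj_on \<phi> (verts Y)" using m dab sxy by (metis distinct_map)
    show "\<phi> ` X = A" "\<phi> ` (verts Y - X) = B" using mx my en by (metis image_set)+
  next
    fix Q e assume Q: "Q \<in> symbols L" and "e \<subseteq> X"
    then obtain I where I: "I \<subseteq> {..<length x}" "(!) x ` I = e"
      using subset_set_conv_index en(6) by metis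
    have "(!) a ` I = \<phi> ` e" using image_nth_map[OF I(1), of \<phi>] I(2) mx by simp
    moreover have "(Q, I) \<in> qf_type (symbols L) M a \<longleftrightarrow> (Q, I) \<in> qf_type (symbols L) Y x"
      using qf by simp
    ultimately show "e \<in> rels Y Q \<longleftrightarrow> \<phi> ` e \<in> rels M Q"
      using I Q len unfolding qf_type_def by auto
  next
    fix Q e assume Q: "Q \<in> symbols L" and e: "e \<subseteq> verts Y" "\<not> e \<subseteq> X" "e \<in> rels Y Q"
    obtain I where I: "I \<subseteq> {..<length ?xy}" "(!) ?xy ` I = e"
      using subset_set_conv_index e(1) sxy by metis
    have img: "(!) ?ab ` I = \<phi> ` e" using image_nth_map[OF I(1), of \<phi>] I(2) m by simp
    have "\<not> I \<subseteq> {..<length x}"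
    proof
      assume "I \<subseteq> {..<length x}"
      hence "e \<subseteq> X" using image_nth_append1[of I x y] I(2) en(6) by (auto simp: nth_mem)
      thus False using e(2) by simp
    qed
    hence "(Q, I) \<in> rqf_type (symbols L) Y x y"
      using I e(3) Q by (simp add: rqf_type_def qf_type_def)
    hence "(Q, I) \<in> rqf_type (symbols L) M a b" using rqf by blast
    thus "\<phi> ` e \<in> rels M Q" using img by (simp add: rqf_type_def qf_type_def)
  qed
  thus "\<exists>\<phi>. copy_map L M A B X Y \<phi>" by (intro exI[of _ \<phi>])
next
  assume "\<exists>\<phi>. copy_map L M A B X Y \<phi>"
  then obtain \<phi> where copy: "copy_map L M A B X Y \<phi>" by blast
  note inj = copy_mapD(1)[OF copy] and img = copy_mapD(2,3)[OF copy]
    and old = copy_mapD(4)[OF copy] and new = copy_mapD(5)[OF copy]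
  obtain x y where x: "distinct x" "set x = X" and y: "distinct y" "set y = verts Y - X"
    using finite_distinct_list[of X] finite_distinct_list[of "verts Y - X"] fin XY
    by (metis finite_Diff finite_subset)
  have sxy: "set (x @ y) = verts Y" and dxy: "distinct (x @ y)" using x y XY by auto
  show "of_form L M A B X Y" unfolding of_form_def
  proof (intro exI conjI)
    show "enumerates (map \<phi> x) A" "enumerates (map \<phi> y) B"
      using x y img inj_on_subset[OF inj, of X] inj_on_subset[OF inj, of "verts Y - X"] XY unfolding enumerates_def
      by (simp_all add: distinct_map)
    show "enumerates x X" "enumerates y (verts Y - X)" using x y by (auto simp: enumerates_def)
    show "length (map \<phi> x) = length x" "length (map \<phi> y) = length y" by auto
    show "qf_type (symbols L) M (map \<phi> x) = qf_type (symbols L) Y x"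
    proof (intro set_eqI iffI; clarify)
      fix Q I assume "(Q, I) \<in> qf_type (symbols L) M (map \<phi> x)"
      hence *: "Q \<in> symbols L" "I \<subseteq> {..<length x}" "\<phi> ` ((!) x ` I) \<in> rels M Q"
        by (auto simp: qf_type_def image_nth_map)
      moreover have "(!) x ` I \<subseteq> X" using *(2) x(2) by (auto simp: nth_mem)
      ultimately show "(Q, I) \<in> qf_type (symbols L) Y x" using old by (simp add: qf_type_def)
    next
      fix Q I assume "(Q, I) \<in> qf_type (symbols L) Y x"
      hence *: "Q \<in> symbols L" "I \<subseteq> {..<length x}" "(!) x ` I \<in> rels Y Q"
        by (auto simp: qf_type_def)
      moreover have "(!) x ` I \<subseteq> X" using *(2) x(2) by (auto simp: nth_mem)
      ultimately show "(Q, I) \<in> qf_type (symbols L) M (map \<phi> x)"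
        using old by (simp add: qf_type_def image_nth_map)
    qed
    show "rqf_type (symbols L) Y x y \<subseteq> rqf_type (symbols L) M (map \<phi> x) (map \<phi> y)"
    proof clarify
      fix Q I assume "(Q, I) \<in> rqf_type (symbols L) Y x y"
      hence *: "Q \<in> symbols L" "I \<subseteq> {..<length (x @ y)}" "(!) (x @ y) ` I \<in> rels Y Q"
          "\<not> I \<subseteq> {..<length x}"
        by (auto simp: rqf_type_def qf_type_def)
      have sub: "(!) (x @ y) ` I \<subseteq> verts Y" using *(2) sxy by (metis image_subset_iff lessThan_iff nth_mem subsetD)
      obtain i where i: "i \<in> I" "\<not> i < length x" "i < length (x @ y)" using *(2,4) by auto
      hence "(x @ y) ! i \<in> set y" by (auto simp: nth_append)
      hence "\<not> (!) (x @ y) ` I \<subseteq> X" using i y by blast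
      hence "\<phi> ` ((!) (x @ y) ` I) \<in> rels M Q" using new * sub by blast
      thus "(Q, I) \<in> rqf_type (symbols L) M (map \<phi> x) (map \<phi> y)"
        using * image_nth_map[OF *(2), of \<phi>] by (simp add: rqf_type_def qf_type_def)
    qed
  qed
qed

section \<open>Counting edges of copies\<close>

definition edges_at :: "nat set \<Rightarrow> struct \<Rightarrow> nat \<Rightarrow> (nat \<times> nat set) set" where
  "edges_at S M v = (SIGMA Q:S. {e \<in> rels M Q. v \<in> e})"

lemma inj_on_image_subset_image_iff:
  assumes "inj_on f C" "A \<subseteq> C" "B \<subseteq> C"
  shows "f ` A \<subseteq> f ` B \<longleftrightarrow> A \<subseteq> B"
proof
  assume sub: "f ` A \<subseteq> f ` B"
  show "A \<subseteq> B"
  proof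
    fix a assume a: "a \<in> A"
    then obtain b where "b \<in> B" "f a = f b" using sub by blast
    thus "a \<in> B" using inj_onD[OF assms(1), of a b] a assms(2,3) by blast
  qed
qed blast

lemma new_edges_split:
  assumes "U \<subseteq> B" "A \<inter> B = {}"
  shows "new_edges S M B A = new_edges S M U A \<union> new_edges S M (B - U) (A \<union> U)"
    and "new_edges S M U A \<inter> new_edges S M (B - U) (A \<union> U) = {}"
proof -
  have "A \<union> U \<union> (B - U) = A \<union> B" using assms by auto
  thus "new_edges S M B A = new_edges S M U A \<union> new_edges S M (B - U) (A \<union> U)"
    using assms(1) unfolding new_edges_def by blast
  show "new_edges S M U A \<inter> new_edges S M (B - U) (A \<union> U) = {}"
    by (auto simp: mem_new_edges)
qed

text \<open>
  A copy inherits from \<open>Y/X\<close> lower bounds on its numbers of edges: \<open>\<phi>\<close> sends distinct edges to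
  distinct edges, and additional relations only help.
\<close>

locale copy =
  fixes L M A B X Y \<phi>
  assumes ext: "msa_ext L X Y" and copy: "copy_map L M A B X Y \<phi>"
begin

lemma XY: "X \<subseteq> verts Y" using msa_extD(2)[OF ext] .

lemma finY: "finite (verts Y)" using msa_extD(3)[OF ext] .

lemmas inj = copy_mapD(1)[OF copy] and img = copy_mapD(2,3)[OF copy]

lemma disj: "A \<inter> B = {}"
  using img inj_on_image_Int[OF inj XY, of "verts Y - X"] by auto

lemma finB: "finite B"
  using finY img(2) by (metis finite_Diff finite_imageI)

lemma nonempty: "B \<noteq> {}"
  using msa_extD(8)[OF ext] img(2) by blast

lemma card_B: "card B = card (verts Y - X)"
  using img(2) inj by (metis Diff_subset card_image inj_on_subset)

lemma image_new_edge:
  assumes "U \<subseteq> verts Y - X" "(Q, e) \<in> new_edges (symbols L) Y (verts Y - X - U) (X \<union> U)"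
  shows "(Q, \<phi> ` e) \<in> new_edges (symbols L) M (B - \<phi> ` U) (A \<union> \<phi> ` U)"
proof -
  have e: "Q \<in> symbols L" "e \<in> rels Y Q" "e \<subseteq> verts Y" "\<not> e \<subseteq> X \<union> U"
    using assms XY by (auto simp: mem_new_edges)
  have "\<phi> ` e \<in> rels M Q" using copy_mapD(5)[OF copy e(1,3)] e by blast
  moreover have "\<phi> ` e \<subseteq> A \<union> B" using e(3) img by blast
  moreover have "\<not> \<phi> ` e \<subseteq> \<phi> ` (X \<union> U)"
    using e(4) assms(1) XY by (subst inj_on_image_subset_image_iff[OF inj e(3)]) auto
  ultimately show ?thesis using e(1) img by (auto simp: mem_new_edges image_Un)
qed

lemma base_vertex_edge:
  assumes "a \<in> A"
  obtains Q e where "(Q, e) \<in> new_edges (symbols L) M B A" "a \<in> e"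
proof -
  obtain x where x: "x \<in> X" "a = \<phi> x" using assms img by blast
  obtain Q e where "(Q, e) \<in> new_edges (symbols L) Y (verts Y - X) X" "x \<in> e"
    using msa_extD(7)[OF ext x(1)] by blast
  thus ?thesis using image_new_edge[of "{}" Q e] x(2) that by auto
qed

lemma inj_image_edges: "inj_on (\<lambda>(Q, e). (Q, \<phi> ` e)) (new_edges (symbols L) Y (verts Y - X - U) (X \<union> U))"
  if "U \<subseteq> verts Y - X"
proof (rule inj_onI)
  let ?E = "new_edges (symbols L) Y (verts Y - X - U) (X \<union> U)"
  fix E E' assume E: "E \<in> ?E" "E' \<in> ?E" and eq: "(\<lambda>(Q, e). (Q, \<phi> ` e)) E = (\<lambda>(Q, e). (Q, \<phi> ` e)) E'"
  have "X \<union> U \<union> (verts Y - X - U) \<subseteq> verts Y" using that XY by auto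
  hence "snd E \<subseteq> verts Y" "snd E' \<subseteq> verts Y" using E unfolding new_edges_def by auto
  thus "E = E'"
    using eq inj_on_image_eq_iff[OF inj, of "snd E" "snd E'"] by (simp add: case_prod_beta prod_eq_iff)
qed

text \<open>
  Split the copy into a part \<open>U\<close> and the rest. In \<open>Y\<close> the preimage \<open>V\<close> of \<open>U\<close> carries at most
  \<open>card V\<close> edges over \<open>X\<close>, and fewer if it is proper and nonempty, while all of \<open>verts Y - X\<close> carries
  as many as it has vertices. The surplus lies on the rest, over the enlarged base.
\<close>

lemma card_new_edges_ge:
  assumes wf: "wf_struct L M" and AM: "A \<subseteq> verts M" "B \<subseteq> verts M" and UB: "U \<subseteq> B"
  shows "card (B - U) \<le> card (new_edges (symbols L) M (B - U) (A \<union> U))"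
    and "U \<noteq> {} \<Longrightarrow> U \<noteq> B \<Longrightarrow> card (B - U) < card (new_edges (symbols L) M (B - U) (A \<union> U))"
proof -
  obtain V where V: "V \<subseteq> verts Y - X" "U = \<phi> ` V"
    using UB img(2) by (metis subset_imageE)
  let ?n = "new_edges (symbols L)"
  have wfY: "wf_struct L Y" using msa_extD(1)[OF ext] .
  have cV: "card U = card V" using V inj by (metis Diff_subset card_image inj_on_subset)
  have fX: "finite X" "finite V" "finite U" using finY XY V finite_subset by blast+
  have "card (?n Y (verts Y - X) X) = card (?n Y V X) + card (?n Y (verts Y - X - V) (X \<union> V))"
    unfolding new_edges_split(1)[OF V(1), of X "symbols L" Y, simplified]
    by (rule card_Un_disjoint)
      (use new_edges_split(2)[OF V(1), of X] XY V fX finY in \<open>auto intro!: finite_new_edges[OF wfY]\<close>)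
  moreover have "card (?n Y (verts Y - X - V) (X \<union> V)) \<le> card (?n M (B - U) (A \<union> U))"
  proof (rule card_inj_on_le[OF inj_image_edges[OF V(1)]])
    show "(\<lambda>(Q, e). (Q, \<phi> ` e)) ` ?n Y (verts Y - X - V) (X \<union> V) \<subseteq> ?n M (B - U) (A \<union> U)"
      using image_new_edge[OF V(1)] V(2) by auto
    have "finite A" using img(1) fX by blast
    thus "finite (?n M (B - U) (A \<union> U))"
      using finB fX AM UB by (intro finite_new_edges[OF wf]) auto
  qed
  moreover have "card (B - U) = card (verts Y - X) - card V"
    using card_Diff_subset[OF fX(3) UB] cV card_B by simp
  moreover have "card (?n Y (verts Y - X) X) = card (verts Y - X)" using msa_extD(4)[OF ext] .
  moreover have "card V \<le> card (verts Y - X)" using V(1) finY by (intro card_mono) auto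
  ultimately have le: "card (B - U) + card V \<le> card (?n Y V X) + card (?n M (B - U) (A \<union> U))"
    by simp
  show "card (B - U) \<le> card (?n M (B - U) (A \<union> U))"
    using le msa_extD(5)[OF ext V(1)] by simp
  assume "U \<noteq> {}" "U \<noteq> B"
  hence "V \<subset> verts Y - X" "V \<noteq> {}" using V img(2) by auto
  thus "card (B - U) < card (?n M (B - U) (A \<union> U))" using le msa_extD(6)[OF ext, of V] by simp
qed

end

text \<open>
  By minimality of the base, every base vertex has an edge to each of the disjoint copies, and
  such edges differ for different copies. Hence a base vertex of degree at most \<open>k\<close> admits at
  most \<open>k\<close> copies, which a \<open>k\<close>-permissive \<open>\<mu>\<close> allows anyway.
\<close>

lemma disjoint_copies_le_degree:
  assumes copies: "\<And>i. i < r \<Longrightarrow> copy L M A (B i) (X i) (Y i) (\<phi> i)"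
    and disj: "disjoint_family_on B {..<r}" and a: "a \<in> A"
    and fin: "finite (edges_at (symbols L) M a)"
  shows "r \<le> card (edges_at (symbols L) M a)"
proof -
  have "\<exists>E. E \<in> new_edges (symbols L) M (B i) A \<and> a \<in> snd E" if "i < r" for i
    using copy.base_vertex_edge[OF copies[OF that] a] by (metis snd_conv)
  then obtain E where E: "\<And>i. i < r \<Longrightarrow> E i \<in> new_edges (symbols L) M (B i) A \<and> a \<in> snd (E i)"
    by metis
  have "inj_on E {..<r}"
  proof (rule inj_onI, rule ccontr)
    fix i j assume ij: "i \<in> {..<r}" "j \<in> {..<r}" "E i = E j" "i \<noteq> j"
    have "B i \<inter> B j = {}" using disjoint_family_onD[OF disj] ij by blast
    moreover have "snd (E i) \<subseteq> A \<union> B i" "\<not> snd (E i) \<subseteq> A" "snd (E i) \<subseteq> A \<union> B j"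
      using E[of i] E[of j] ij by (auto simp: new_edges_def)
    ultimately show False by blast
  qed
  moreover have "E ` {..<r} \<subseteq> edges_at (symbols L) M a"
    using E by (force simp: new_edges_def edges_at_def)
  ultimately have "card {..<r} \<le> card (edges_at (symbols L) M a)"
    using fin by (rule card_inj_on_le)
  thus ?thesis by simp
qed

section \<open>Free joins over the base of a minimally simply algebraic extension\<close>

locale free_amalgam =
  fixes L X Y Z
  assumes ext: "msa_ext L X Y" and wfZ: "wf_struct L Z" and finZ: "finite (verts Z)"
    and meet: "verts Y \<inter> verts Z = X" and agree: "induced_eq L Y Z X"
begin

lemmas wfY = msa_extD(1)[OF ext] and XY = msa_extD(2)[OF ext] and finY = msa_extD(3)[OF ext]

lemma verts_join: "verts (free_join Y Z) = verts Z \<union> (verts Y - X)"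
  using meet by (auto simp: free_join_def)

lemma rels_join: "rels (free_join Y Z) Q = rels Y Q \<union> rels Z Q"
  by (simp add: free_join_def)

lemma rels_join_Z:
  assumes "e \<subseteq> verts Z"
  shows "e \<in> rels (free_join Y Z) Q \<longleftrightarrow> e \<in> rels Z Q"
proof -
  have "e \<in> rels Z Q" if "e \<in> rels Y Q"
  proof -
    have "Q \<in> symbols L" "e \<subseteq> X" using wf_struct_relsD[OF wfY that] assms meet by blast+
    thus ?thesis using agree that by (auto simp: induced_eq_def occurrences_def)
  qed
  thus ?thesis by (auto simp: rels_join)
qed

lemma rels_join_Y:
  assumes "e \<subseteq> verts Y"
  shows "e \<in> rels (free_join Y Z) Q \<longleftrightarrow> e \<in> rels Y Q"
proof -
  have "e \<in> rels Y Q" if "e \<in> rels Z Q"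
  proof -
    have "Q \<in> symbols L" "e \<subseteq> X" using wf_struct_relsD[OF wfZ that] assms meet by blast+
    thus ?thesis using agree that by (auto simp: induced_eq_def occurrences_def)
  qed
  thus ?thesis by (auto simp: rels_join)
qed

lemma wf_join: "wf_struct L (free_join Y Z)"
  unfolding wf_struct_def
proof (intro conjI allI impI ballI)
  fix Q e assume "e \<in> rels (free_join Y Z) Q"
  hence "e \<in> rels Y Q \<or> e \<in> rels Z Q" by (simp add: rels_join)
  thus "Q \<in> symbols L" "e \<subseteq> verts (free_join Y Z)" "finite e" "card e = arity L Q"
    using wf_struct_relsD[OF wfY] wf_struct_relsD[OF wfZ] unfolding free_join_def by auto blast+
next
  fix A
  have "finite (SIGMA Q:symbols L. occurrences Y Q (verts Y))"
    and "finite (SIGMA Q:symbols L. occurrences Z Q (verts Z))"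
    using finite_occurrences[OF wfY finY] finite_occurrences[OF wfZ finZ] by blast+
  moreover have "(SIGMA Q:symbols L. occurrences (free_join Y Z) Q A) \<subseteq>
    (SIGMA Q:symbols L. occurrences Y Q (verts Y)) \<union> (SIGMA Q:symbols L. occurrences Z Q (verts Z))"
    using wf_struct_relsD(2)[OF wfY] wf_struct_relsD(2)[OF wfZ]
    unfolding occurrences_def rels_join by blast
  ultimately show "finite (SIGMA Q:symbols L. occurrences (free_join Y Z) Q A)"
    using finite_subset by blast
qed

lemma finite_join: "finite (verts (free_join Y Z))"
  using finY finZ by (simp add: free_join_def)

text \<open>
  An edge of the join that meets \<open>verts Y - X\<close> must be an edge of \<open>Y\<close>, so only the part of the
  base in \<open>X\<close> matters.
\<close>

lemma new_edges_join:
  assumes "U \<subseteq> verts Y - X" "A \<subseteq> verts Z"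
  shows "new_edges S (free_join Y Z) U A = new_edges S Y U (A \<inter> X)"
proof (intro set_eqI iffI; clarify)
  fix Q e assume "(Q, e) \<in> new_edges S (free_join Y Z) U A"
  hence e: "Q \<in> S" "e \<in> rels Y Q \<or> e \<in> rels Z Q" "e \<subseteq> A \<union> U" "\<not> e \<subseteq> A"
    by (auto simp: mem_new_edges rels_join)
  have "\<not> e \<subseteq> verts Z" using e assms meet by blast
  hence eY: "e \<in> rels Y Q" using e wf_struct_relsD(2)[OF wfZ] by blast
  hence "e \<subseteq> verts Y" using wf_struct_relsD(2)[OF wfY] by blast
  hence "e \<subseteq> (A \<inter> X) \<union> U" using e(3) assms meet by blast
  thus "(Q, e) \<in> new_edges S Y U (A \<inter> X)" using e eY by (auto simp: mem_new_edges)
next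
  fix Q e assume e: "(Q, e) \<in> new_edges S Y U (A \<inter> X)"
  hence "\<not> e \<subseteq> A" using assms meet by (auto simp: mem_new_edges)
  thus "(Q, e) \<in> new_edges S (free_join Y Z) U A"
    using e by (auto simp: mem_new_edges rels_join)
qed

text \<open>
  Restricting the language removes edges, so the bound given by strength of \<open>X\<close> in \<open>Y\<close> holds for
  every sublanguage. This is why the join changes none of the values of \<open>g\<close>, which refer to
  finite parts of the language.
\<close>

lemma card_new_edges_join_le:
  assumes "U \<subseteq> verts Y - X" "A \<subseteq> verts Z" "S \<subseteq> symbols L"
  shows "card (new_edges S (free_join Y Z) U A) \<le> card U"
proof -
  have "new_edges S (free_join Y Z) U A \<subseteq> new_edges (symbols L) Y U X"
    unfolding new_edges_join[OF assms(1,2)] using assms by (intro new_edges_mono) auto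
  moreover have "finite (new_edges (symbols L) Y U X)"
    using assms(1) XY finY finite_subset[OF XY] finite_subset[of U "verts Y"]
    by (intro finite_new_edges[OF wfY]) auto
  ultimately have "card (new_edges S (free_join Y Z) U A) \<le> card (new_edges (symbols L) Y U X)"
    by (intro card_mono)
  also have "\<dots> \<le> card U" using msa_extD(5)[OF ext assms(1)] .
  finally show ?thesis .
qed

lemma delta_join_Z:
  assumes "A \<subseteq> verts Z"
  shows "delta S (free_join Y Z) A = delta S Z A"
proof -
  have "occurrences (free_join Y Z) Q A = occurrences Z Q A" for Q
    using assms rels_join_Z by (auto simp: occurrences_def)
  thus ?thesis by (simp add: delta_def)
qed

text \<open>
  Cutting a set down to \<open>Z\<close> does not raise its predimension: this gives both \<open>C0\<close> for the join
  and, since the cut also shrinks the set, the invariance of \<open>g\<close>.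
\<close>

lemma delta_join_ge:
  assumes "D \<subseteq> verts (free_join Y Z)" "S \<subseteq> symbols L"
  shows "delta S Z (D \<inter> verts Z) \<le> delta S (free_join Y Z) D"
proof -
  let ?U = "D - verts Z"
  have U: "?U \<subseteq> verts Y - X" using assms(1) by (auto simp: verts_join)
  have fin: "finite D" using assms(1) finite_join finite_subset by blast
  have "D = (D \<inter> verts Z) \<union> ?U" by blast
  hence "delta S (free_join Y Z) D = delta S (free_join Y Z) (D \<inter> verts Z)
     + int (card ?U) - int (card (new_edges S (free_join Y Z) ?U (D \<inter> verts Z)))"
    using delta_Un[OF wf_join, of "D \<inter> verts Z" ?U S] fin assms by (metis (no_types, lifting)
      Diff_subset Int_Diff_disjoint Int_lower1 finite_Diff finite_Int le_inf_iff order_trans Int_assoc Diff_disjoint Int_empty_right)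
  moreover have "card (new_edges S (free_join Y Z) ?U (D \<inter> verts Z)) \<le> card ?U"
    using U assms(2) by (intro card_new_edges_join_le) auto
  ultimately show ?thesis using delta_join_Z[of "D \<inter> verts Z" S] by simp
qed

lemma drops_within_join:
  assumes "A \<subseteq> verts Z"
  shows "drops_within L (free_join Y Z) A m \<longleftrightarrow> drops_within L Z A m"
proof
  let ?S = "symbols L \<inter> {..<m}"
  assume "drops_within L (free_join Y Z) A m"
  then obtain D where D: "A \<subseteq> D" "D \<subseteq> verts (free_join Y Z)" "finite D" "card D \<le> card A + m"
      "delta ?S (free_join Y Z) D < delta ?S (free_join Y Z) A"
    unfolding drops_within_def by blast
  have "card (D \<inter> verts Z) \<le> card D" using D(3) by (intro card_mono) auto
  moreover have "delta ?S Z (D \<inter> verts Z) < delta ?S Z A"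
    using delta_join_ge[OF D(2), of ?S] D(5) delta_join_Z[OF assms, of ?S] by simp
  ultimately show "drops_within L Z A m"
    unfolding drops_within_def using D assms by (intro exI[of _ "D \<inter> verts Z"]) auto
next
  assume "drops_within L Z A m"
  then obtain D where D: "A \<subseteq> D" "D \<subseteq> verts Z" "finite D" "card D \<le> card A + m"
      "delta (symbols L \<inter> {..<m}) Z D < delta (symbols L \<inter> {..<m}) Z A"
    unfolding drops_within_def by blast
  thus "drops_within L (free_join Y Z) A m"
    unfolding drops_within_def using assms delta_join_Z
    by (intro exI[of _ D]) (auto simp: verts_join)
qed

lemma g_join: "A \<subseteq> verts Z \<Longrightarrow> g L (free_join Y Z) A = g L Z A"
  unfolding g_def using drops_within_join by presburger

lemma C0_join:
  assumes "Z \<in> C0 L"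
  shows "free_join Y Z \<in> C0 L"
proof -
  have "0 \<le> delta (symbols L) (free_join Y Z) D" if "D \<subseteq> verts (free_join Y Z)" for D
  proof -
    have "0 \<le> delta (symbols L) Z (D \<inter> verts Z)"
      using assms finZ by (auto simp: C0_def)
    thus ?thesis using delta_join_ge[OF that order_refl] by simp
  qed
  thus ?thesis using wf_join by (simp add: C0_def)
qed

lemma edges_at_join:
  assumes "w \<in> verts Y - X"
  shows "edges_at S (free_join Y Z) w = edges_at S Y w"
proof -
  have "w \<notin> verts Z" using assms meet by blast
  thus ?thesis using wf_struct_relsD(2)[OF wfZ] by (auto simp: edges_at_def rels_join)
qed

lemma finite_edges_at: "finite (edges_at (symbols L) Y w)"
proof (rule finite_subset)
  show "edges_at (symbols L) Y w \<subseteq> (SIGMA Q:symbols L. occurrences Y Q (verts Y))"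
    using wf_struct_relsD(2)[OF wfY] by (auto simp: edges_at_def occurrences_def)
  show "finite (SIGMA Q:symbols L. occurrences Y Q (verts Y))"
    using finite_occurrences[OF wfY finY] by blast
qed

text \<open>
  The rigidity behind unblockability: a copy over a base in \<open>Z\<close> cannot meet the new part
  \<open>verts Y - X\<close> unless it is the new part, with base \<open>X\<close>. A copy having vertices on both sides
  would, by the strict surplus of edges on a proper part, have more edges on its part outside
  \<open>Z\<close> than it has vertices there, against strength of \<open>X\<close> in \<open>Y\<close>. So the copy lies in
  \<open>verts Y - X\<close>; having as many edges as vertices over a subset of \<open>X\<close>, it is everything, and it
  uses up all edges of \<open>Y\<close> outside \<open>X\<close>. This leaves no room for another base or for additional
  relations, so it is an isomorphic copy.
\<close>

lemma copy_meeting_extension: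
  assumes copy: "copy L (free_join Y Z) A B X' Y' \<phi>"
    and A: "A \<subseteq> verts Z" and B: "B \<subseteq> verts (free_join Y Z)" and meets: "\<not> B \<subseteq> verts Z"
  shows "B = verts Y - X" "A = X" "ext_iso L X' Y' X Y"
proof -
  interpret c: copy L "free_join Y Z" A B X' Y' \<phi> by (rule copy)
  let ?C = "free_join Y Z" and ?W = "verts Y - X" and ?n = "new_edges (symbols L)"
  have AC: "A \<subseteq> verts ?C" using A by (auto simp: verts_join)
  have BW: "B - verts Z \<subseteq> ?W" using B by (auto simp: verts_join)
  have Un: "B - (B \<inter> verts Z) = B - verts Z" by blast
  \<comment> \<open>strict surplus against strength rules out vertices on both sides\<close>
  have "card (?n ?C (B - verts Z) (A \<union> (B \<inter> verts Z))) \<le> card (B - verts Z)"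
    using A by (intro card_new_edges_join_le[OF BW]) auto
  hence "B \<inter> verts Z = {}"
    using c.card_new_edges_ge(2)[OF wf_join AC B, of "B \<inter> verts Z"] meets Un by auto
  hence BW: "B \<subseteq> ?W" using BW by blast
  have nB: "?n ?C B A = ?n Y B (A \<inter> X)" by (rule new_edges_join[OF BW A])
  have finn: "finite (?n Y ?W X)"
    using finY XY finite_subset[OF XY] by (intro finite_new_edges[OF wfY]) auto
  have sub: "?n Y B (A \<inter> X) \<subseteq> ?n Y B X" "?n Y B X \<subseteq> ?n Y ?W X"
    using BW by (intro new_edges_mono; auto)+
  have "card B \<le> card (?n Y B (A \<inter> X))"
    using c.card_new_edges_ge(1)[OF wf_join AC B, of "{}"] nB by simp
  moreover have "card (?n Y B (A \<inter> X)) \<le> card (?n Y B X)"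
    using sub finn finite_subset by (intro card_mono) auto
  ultimately have cB: "card B \<le> card (?n Y B X)" by simp
  show BeqW: "B = ?W"
    using msa_extD(6)[OF ext, of B] cB BW c.nonempty by (metis linorder_not_less psubsetI)
  \<comment> \<open>already the part of \<open>X\<close> inside \<open>A\<close> sees all edges of \<open>Y\<close> outside \<open>X\<close>\<close>
  have "card (?n Y ?W X) \<le> card (?n Y ?W (A \<inter> X))"
    using \<open>card B \<le> card (?n Y B (A \<inter> X))\<close> BeqW msa_extD(4)[OF ext] by simp
  hence eq: "?n Y ?W (A \<inter> X) = ?n Y ?W X"
    using sub(1) BeqW finn card_seteq by metis
  have "X \<subseteq> A"
  proof
    fix x assume x: "x \<in> X"
    then obtain Q e where "(Q, e) \<in> ?n Y ?W X" "x \<in> e" using msa_extD(7)[OF ext] by blast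
    hence "x \<in> A \<inter> X \<union> ?W" using eq by (metis mem_new_edges subsetD)
    thus "x \<in> A" using x by blast
  qed
  moreover have "A \<subseteq> X"
  proof
    fix a assume "a \<in> A"
    then obtain Q e where "(Q, e) \<in> ?n ?C B A" "a \<in> e" by (rule c.base_vertex_edge)
    hence "a \<in> A \<inter> X \<union> B" using nB by (metis mem_new_edges subsetD)
    thus "a \<in> X" using \<open>a \<in> A\<close> c.disj by blast
  qed
  ultimately show AX: "A = X" by blast
  have imgV: "\<phi> ` verts Y' = verts Y"
    using c.img AX BeqW c.XY XY by (metis Diff_partition image_Un)
  \<comment> \<open>equal cardinalities leave no edges beyond the images of those of \<open>Y'\<close>\<close>
  let ?N' = "?n Y' (verts Y' - X') X'" and ?f = "\<lambda>(Q, e). (Q, \<phi> ` e)"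
  have inj': "inj_on ?f ?N'" using c.inj_image_edges[of "{}"] by simp
  have "?f ` ?N' \<subseteq> ?n Y ?W X"
    using c.image_new_edge[of "{}"] nB BeqW AX by auto
  moreover have "card (?f ` ?N') = card (?n Y ?W X)"
    using card_image[OF inj'] msa_extD(4)[OF ext] msa_extD(4)[OF c.ext] c.card_B BeqW by simp
  ultimately have onto: "?f ` ?N' = ?n Y ?W X" using finn card_subset_eq by blast
  show "ext_iso L X' Y' X Y" unfolding ext_iso_def
  proof (intro exI[of _ \<phi>] conjI ballI allI impI)
    show "bij_betw \<phi> (verts Y') (verts Y)" using c.inj imgV by (simp add: bij_betw_def)
    show "\<phi> ` X' = X" using c.img AX by simp
    fix Q e assume Q: "Q \<in> symbols L" and e: "e \<subseteq> verts Y'"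
    have eY: "\<phi> ` e \<subseteq> verts Y" using e imgV by blast
    show "e \<in> rels Y' Q \<longleftrightarrow> \<phi> ` e \<in> rels Y Q"
    proof (cases "e \<subseteq> X'")
      case True
      thus ?thesis using copy_mapD(4)[OF c.copy Q True] rels_join_Y[OF eY] by simp
    next
      case False
      have "\<not> \<phi> ` e \<subseteq> X"
        using False e inj_on_image_subset_image_iff[OF c.inj e c.XY] c.img AX by simp
      hence "\<phi> ` e \<in> rels Y Q \<longleftrightarrow> (Q, \<phi> ` e) \<in> ?n Y ?W X"
        using Q eY by (auto simp: mem_new_edges)
      also have "\<dots> \<longleftrightarrow> (Q, \<phi> ` e) \<in> ?f ` ?N'" using onto by simp
      also have "\<dots> \<longleftrightarrow> (Q, e) \<in> ?N'"
      proof
        assume "(Q, \<phi> ` e) \<in> ?f ` ?N'"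
        then obtain e' where e': "(Q, e') \<in> ?N'" "\<phi> ` e = \<phi> ` e'" by auto
        hence "e' \<subseteq> verts Y'" using c.XY by (auto simp: mem_new_edges)
        thus "(Q, e) \<in> ?N'" using e' inj_on_image_eq_iff[OF c.inj e] by metis
      qed force
      also have "\<dots> \<longleftrightarrow> e \<in> rels Y' Q" using Q e False by (auto simp: mem_new_edges)
      finally show ?thesis by simp
    qed
  qed
qed

end

section \<open>Extensions of small degree are unblockable\<close>

lemma (in free_amalgam) copy_map_in_Z:
  assumes copy: "copy_map L (free_join Y Z) A B X' Y' \<phi>" and AB: "A \<subseteq> verts Z" "B \<subseteq> verts Z"
    and XY': "X' \<subseteq> verts Y'"
  shows "copy_map L Z A B X' Y' \<phi>"
proof -
  have "\<phi> ` verts Y' \<subseteq> verts Z"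
    using copy_mapD(2,3)[OF copy] AB XY' by blast
  hence "\<phi> ` e \<in> rels (free_join Y Z) Q \<longleftrightarrow> \<phi> ` e \<in> rels Z Q" if "e \<subseteq> verts Y'" for e Q
    using that by (intro rels_join_Z) blast
  thus ?thesis using copy XY' unfolding copy_map_def by (meson subset_trans)
qed

lemma ext_iso_sym:
  assumes "ext_iso L X Y X' Y'" and XY: "X \<subseteq> verts Y"
  shows "ext_iso L X' Y' X Y"
proof -
  obtain f where f: "bij_betw f (verts Y) (verts Y')" "f ` X = X'"
    and rel: "\<And>Q e. Q \<in> symbols L \<Longrightarrow> e \<subseteq> verts Y \<Longrightarrow> e \<in> rels Y Q \<longleftrightarrow> f ` e \<in> rels Y' Q"
    using assms(1) unfolding ext_iso_def by blast
  define h where "h = inv_into (verts Y) f"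
  have h: "bij_betw h (verts Y') (verts Y)" using f(1) by (simp add: h_def bij_betw_inv_into)
  have hf: "h ` f ` D = D" if "D \<subseteq> verts Y" for D
    using f(1) that by (simp add: h_def bij_betw_def inv_into_image_cancel)
  have fh: "f ` h ` D = D" if "D \<subseteq> verts Y'" for D
    using f(1) that by (simp add: h_def bij_betw_def image_inv_into_cancel)
  show ?thesis unfolding ext_iso_def
  proof (intro exI[of _ h] conjI ballI allI impI h)
    show "h ` X' = X" using hf[OF XY] f(2) by simp
    fix Q e assume "Q \<in> symbols L" "e \<subseteq> verts Y'"
    moreover from this have "h ` e \<subseteq> verts Y" using h by (auto simp: bij_betw_def)
    ultimately show "e \<in> rels Y' Q \<longleftrightarrow> h ` e \<in> rels Y Q" using rel fh by metis
  qed
qed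

lemma copy_map_ext_iso:
  assumes iso: "ext_iso L X Y X' Y'" and XY: "X \<subseteq> verts Y" and copy: "copy_map L M A B X' Y' \<phi>"
  obtains \<psi> where "copy_map L M A B X Y \<psi>"
proof -
  obtain f where f: "bij_betw f (verts Y) (verts Y')" "f ` X = X'"
    and rel: "\<And>Q e. Q \<in> symbols L \<Longrightarrow> e \<subseteq> verts Y \<Longrightarrow> e \<in> rels Y Q \<longleftrightarrow> f ` e \<in> rels Y' Q"
    using iso unfolding ext_iso_def by blast
  have injf: "inj_on f (verts Y)" and fV: "f ` verts Y = verts Y'"
    using f(1) by (auto simp: bij_betw_def)
  have fW: "f ` (verts Y - X) = verts Y' - X'"
    using inj_on_image_set_diff[OF injf, of "verts Y" X] XY fV f(2) by auto
  have "copy_map L M A B X Y (\<phi> \<circ> f)" unfolding copy_map_def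
  proof (intro conjI ballI allI impI)
    show "inj_on (\<phi> \<circ> f) (verts Y)"
      using injf copy_mapD(1)[OF copy] fV by (intro comp_inj_on) auto
    show "(\<phi> \<circ> f) ` X = A" "(\<phi> \<circ> f) ` (verts Y - X) = B"
      using f(2) fW copy_mapD(2,3)[OF copy] by (simp_all only: image_comp[symmetric])
  next
    fix Q e assume Q: "Q \<in> symbols L" and e: "e \<subseteq> X"
    hence "e \<subseteq> verts Y" "f ` e \<subseteq> X'" using XY f(2) by auto
    thus "e \<in> rels Y Q \<longleftrightarrow> (\<phi> \<circ> f) ` e \<in> rels M Q"
      using rel[OF Q] copy_mapD(4)[OF copy Q] by (simp only: image_comp[symmetric])
  next
    fix Q e assume Q: "Q \<in> symbols L" and e: "e \<subseteq> verts Y" "\<not> e \<subseteq> X" "e \<in> rels Y Q"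
    have "f ` e \<subseteq> verts Y'" using e(1) fV by blast
    moreover have "\<not> f ` e \<subseteq> X'"
      using e(2) inj_on_image_subset_image_iff[OF injf e(1) XY] f(2) by simp
    moreover have "f ` e \<in> rels Y' Q" using rel[OF Q e(1)] e(3) by simp
    ultimately show "(\<phi> \<circ> f) ` e \<in> rels M Q"
      using copy_mapD(5)[OF copy Q] by (simp only: image_comp[symmetric])
  qed
  thus ?thesis using that by blast
qed

lemma disjoint_family_on_omit:
  fixes B :: "nat \<Rightarrow> 'a set"
  assumes "disjoint_family_on B {..<r}" and "n < r"
  obtains s where "\<And>j. j < n \<Longrightarrow> s j < r \<and> s j \<noteq> i" and "disjoint_family_on (B \<circ> s) {..<n}"
proof
  define s where "s j = (if j < i then j else Suc j)" for j
  show s: "s j < r \<and> s j \<noteq> i" if "j < n" for j using that assms(2) by (auto simp: s_def)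
  have "s j \<noteq> s j'" if "j \<noteq> j'" for j j' using that by (auto simp: s_def split: if_splits)
  thus "disjoint_family_on (B \<circ> s) {..<n}"
    using assms(1) s unfolding disjoint_family_on_def by (metis comp_apply lessThan_iff)
qed

lemma mult_function_ext_iso:
  assumes "mult_function L R \<mu>" "msa_ext L X Y" "msa_ext L X' Y'" "ext_iso L X' Y' X Y"
  shows "\<mu> X' Y' m = \<mu> X Y m"
  using conjunct1[OF assms(1)[unfolded mult_function_def]] assms(2-4) by simp

lemma C_muI:
  assumes "C \<in> C0 L" "finite (verts C)"
    and "\<And>A B r X Y. A \<subseteq> verts C \<Longrightarrow> (\<And>i. i < r \<Longrightarrow> B i \<subseteq> verts C \<and> A \<inter> B i = {}) \<Longrightarrow>
      disjoint_family_on B {..<r} \<Longrightarrow> msa_ext L X Y \<Longrightarrow>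
      (\<And>i. i < r \<Longrightarrow> of_form L C A (B i) X Y) \<Longrightarrow> r \<le> \<mu> X Y (g L C A)"
  shows "C \<in> C_mu L \<mu>"
  unfolding C_mu_def
proof (intro CollectI conjI allI impI assms(1,2); elim conjE)
  fix A B X Y and r :: nat
  assume "A \<subseteq> verts C" "\<forall>i<r. B i \<subseteq> verts C \<and> A \<inter> B i = {}" "disjoint_family_on B {..<r}"
    "msa_ext L X Y" "\<forall>i<r. of_form L C A (B i) X Y"
  thus "r \<le> \<mu> X Y (g L C A)" using assms(3)[of A r B X Y] by simp
qed

lemma C_muD:
  assumes "C \<in> C_mu L \<mu>" "A \<subseteq> verts C" "\<And>i. i < r \<Longrightarrow> B i \<subseteq> verts C \<and> A \<inter> B i = {}"
    "disjoint_family_on B {..<r}" "msa_ext L X Y" "\<And>i. i < r \<Longrightarrow> of_form L C A (B i) X Y"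
  shows "r \<le> \<mu> X Y (g L C A)"
proof -
  have "\<forall>A B (r::nat) X Y.
        A \<subseteq> verts C \<and> (\<forall>i<r. B i \<subseteq> verts C \<and> A \<inter> B i = {}) \<and> disjoint_family_on B {..<r} \<and>
        msa_ext L X Y \<and> (\<forall>i<r. of_form L C A (B i) X Y)
        \<longrightarrow> r \<le> \<mu> X Y (g L C A)"
    using assms(1) unfolding C_mu_def by (elim CollectE conjE)
  from this[THEN spec, THEN spec, THEN spec, THEN spec, THEN spec, of A r B X Y]
  show ?thesis using assms(2-6) by simp
qed

text \<open>
  Suppose that the join contains \<open>r\<close> disjoint copies of some \<open>Y'/X'\<close> over \<open>A\<close>, and that \<open>r > k\<close>. The degree
  bound forces \<open>A\<close> into \<open>Z\<close>. If all copies lie in \<open>Z\<close>, then \<open>Z\<close> bounds \<open>r\<close>, as \<open>g\<close> does not change.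
  Otherwise one of them is the new part itself, \<open>Y'/X'\<close> is isomorphic to \<open>Y/X\<close>, and the other \<open>r - 1\<close>
  copies lie in \<open>Z\<close>; if there were too many copies in the join, these would be the copies
  demanded by the second alternative.
\<close>

theorem (in free_amalgam) join_in_C_mu_or_copies:
  assumes deg: "\<And>w. w \<in> verts Y - X \<Longrightarrow> card (edges_at (symbols L) Y w) \<le> k"
    and mult: "mult_function L R \<mu>" and perm: "permissive L k \<mu>" and Z: "Z \<in> C_mu L \<mu>"
  shows "free_join Y Z \<in> C_mu L \<mu> \<or> has_disjoint_copies L Z (\<mu> X Y (g L Z X)) X Y"
proof (rule disjCI)
  assume no: "\<not> has_disjoint_copies L Z (\<mu> X Y (g L Z X)) X Y"
  let ?C = "free_join Y Z"
  have bound: "r \<le> \<mu> X' Y' (g L ?C A)"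
    if H: "A \<subseteq> verts ?C" "\<And>i. i < r \<Longrightarrow> B i \<subseteq> verts ?C \<and> A \<inter> B i = {}"
      and disj: "disjoint_family_on B {..<r}" and ext': "msa_ext L X' Y'"
      and form: "\<And>i. i < r \<Longrightarrow> of_form L ?C A (B i) X' Y'" for A B X' Y' and r :: nat
  proof (cases "r \<le> k")
    case True
    have "k \<le> \<mu> X' Y' (g L ?C A)" using perm ext' unfolding permissive_def by blast
    with True show ?thesis by linarith
  next
    case False
    note XY' = msa_extD(2)[OF ext'] and fin' = msa_extD(3)[OF ext']
    have "\<exists>\<phi>. copy_map L ?C A (B i) X' Y' \<phi>" if "i < r" for i
      using form[OF that] of_form_iff_copy_map[OF fin' XY'] H(2)[OF that] by blast
    then obtain \<phi> where \<phi>: "\<And>i. i < r \<Longrightarrow> copy_map L ?C A (B i) X' Y' (\<phi> i)" by metis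
    hence copies: "copy L ?C A (B i) X' Y' (\<phi> i)" if "i < r" for i
      using that ext' by unfold_locales auto
    have AZ: "A \<subseteq> verts Z"
    proof (rule ccontr)
      assume "\<not> A \<subseteq> verts Z"
      then obtain a where a: "a \<in> A" "a \<in> verts Y - X" using H(1) by (auto simp: verts_join)
      have "r \<le> card (edges_at (symbols L) ?C a)"
        using copies disj a(1)
        by (rule disjoint_copies_le_degree) (simp_all add: edges_at_join[OF a(2)] finite_edges_at)
      also have "\<dots> \<le> k" using deg[OF a(2)] by (simp add: edges_at_join[OF a(2)])
      finally show False using False by simp
    qed
    have formZ: "of_form L Z A (B i) X' Y'" if "i < r" "B i \<subseteq> verts Z" for i
      using of_form_iff_copy_map[OF fin' XY'] H(2)[OF that(1)] copy_map_in_Z[OF \<phi>[OF that(1)] AZ that(2) XY']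
      by blast
    show ?thesis
    proof (cases "\<forall>i<r. B i \<subseteq> verts Z")
      case True
      have "r \<le> \<mu> X' Y' (g L Z A)"
        using True H(2) formZ by (intro C_muD[OF Z AZ _ disj ext']) blast+
      thus ?thesis using g_join[OF AZ] by simp
    next
      case False
      then obtain i where i: "i < r" "\<not> B i \<subseteq> verts Z" by blast
      note whole = copy_meeting_extension[OF copies[OF i(1)] AZ _ i(2)]
      have Bi: "B i = verts Y - X" and AX: "A = X" and iso: "ext_iso L X' Y' X Y"
        using whole H(2)[OF i(1)] by simp_all
      note iso' = ext_iso_sym[OF iso XY']
      have \<mu>eq: "\<mu> X' Y' m = \<mu> X Y m" for m
        using mult ext ext' iso by (rule mult_function_ext_iso)
      show ?thesis
      proof (rule ccontr)
        assume "\<not> r \<le> \<mu> X' Y' (g L ?C A)"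
        hence less: "\<mu> X Y (g L Z X) < r" using \<mu>eq g_join[OF AZ] AX by simp
        obtain s where s: "\<And>j. j < \<mu> X Y (g L Z X) \<Longrightarrow> s j < r \<and> s j \<noteq> i"
          and disjs: "disjoint_family_on (B \<circ> s) {..<\<mu> X Y (g L Z X)}"
          using disjoint_family_on_omit[OF disj less, of i] by blast
        have "B j \<subseteq> verts Z \<and> X \<inter> B j = {} \<and> of_form L Z X (B j) X Y" if j: "j < r" "j \<noteq> i" for j
        proof -
          have "B j \<inter> B i = {}" using disjoint_family_onD[OF disj] j i(1) by blast
          hence BZ: "B j \<subseteq> verts Z" using H(2)[OF j(1)] Bi by (auto simp: verts_join)
          have "copy_map L Z X (B j) X' Y' (\<phi> j)"
            using copy_map_in_Z[OF \<phi>[OF j(1)] AZ BZ XY'] AX by simp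
          then obtain \<psi> where "copy_map L Z X (B j) X Y \<psi>"
            using copy_map_ext_iso[OF iso' XY] by blast
          moreover have "X \<inter> B j = {}" using H(2)[OF j(1)] AX by blast
          ultimately show ?thesis using BZ of_form_iff_copy_map[OF finY XY] by blast
        qed
        hence "has_disjoint_copies L Z (\<mu> X Y (g L Z X)) X Y"
          unfolding has_disjoint_copies_def using disjs s by (intro exI[of _ "B \<circ> s"]) auto
        with no show False by blast
      qed
    qed
  qed
  have "?C \<in> C0 L" using Z C0_join by (simp add: C_mu_def)
  thus "?C \<in> C_mu L \<mu>" using finite_join by (rule C_muI) (rule bound)
qed

theorem unblockable_of_degree_le:
  assumes "msa_ext L X Y" and "\<And>w. w \<in> verts Y - X \<Longrightarrow> card (edges_at (symbols L) Y w) \<le> k"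
  shows "unblockable L R k X Y"
  unfolding unblockable_def
proof (intro conjI assms allI impI ballI)
  fix \<mu> Z
  assume \<mu>: "mult_function L R \<mu> \<and> permissive L k \<mu> \<and> Y \<in> C_mu L \<mu>"
    and Z: "Z \<in> C_mu L \<mu>" and join: "verts Y \<inter> verts Z = X \<and> induced_eq L Y Z X"
  interpret free_amalgam L X Y Z
    using assms(1) Z join by unfold_locales (auto simp: C_mu_def C0_def)
  show "free_join Y Z \<in> C_mu L \<mu> \<or> has_disjoint_copies L Z (\<mu> X Y (g L Z X)) X Y"
    using join_in_C_mu_or_copies assms(2) \<mu> Z by blast
qed

lemma no_copy_in_discrete:
  assumes wf: "wf_struct L Z" and "finite (verts Z)" and empty: "\<And>Q. rels Z Q = {}"
    and ext: "msa_ext L X Y" and AB: "A \<subseteq> verts Z" "B \<subseteq> verts Z" "A \<inter> B = {}"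
  shows "\<not> of_form L Z A B X Y"
proof
  assume "of_form L Z A B X Y"
  then obtain \<phi> where "copy_map L Z A B X Y \<phi>"
    using of_form_iff_copy_map[OF msa_extD(3,2)[OF ext] AB(3)] by blast
  then interpret copy L Z A B X Y \<phi> using ext by unfold_locales
  have "card B \<le> card (new_edges (symbols L) Z B A)"
    using card_new_edges_ge(1)[OF wf AB(1,2), of "{}"] by simp
  moreover have "new_edges (symbols L) Z B A = {}" using empty by (auto simp: new_edges_def)
  ultimately show False using finB nonempty by simp
qed

text \<open>
  \<open>Y\<close> is its own free join with the relation-free structure \<open>Z\<close> on \<open>X\<close>. As \<open>Z\<close> contains no copy
  of any extension, it lies in the class and the second alternative fails for it.
\<close>

theorem extension_of_discrete_in_C_mu:
  assumes ext: "msa_ext L X Y" and deg: "\<And>w. w \<in> verts Y - X \<Longrightarrow> card (edges_at (symbols L) Y w) \<le> k"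
    and "0 < k" and discrete: "\<And>Q. occurrences Y Q X = {}"
    and mult: "mult_function L R \<mu>" and perm: "permissive L k \<mu>"
  shows "Y \<in> C_mu L \<mu>"
proof -
  define Z :: struct where "Z = \<lparr>verts = X, rels = (\<lambda>_. {})\<rparr>"
  have finX: "finite X" using msa_extD(2,3)[OF ext] finite_subset by blast
  have wf: "wf_struct L Z" by (auto simp: Z_def wf_struct_def occurrences_def)
  note none = no_copy_in_discrete[OF wf]
  have join: "free_join Y Z = Y" using msa_extD(2)[OF ext] by (simp add: free_join_def Z_def Un_absorb2)
  have ZC: "Z \<in> C_mu L \<mu>"
  proof (rule C_muI)
    show "Z \<in> C0 L" using wf by (simp add: C0_def Z_def delta_def occurrences_def)
    show "finite (verts Z)" using finX by (simp add: Z_def)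
    fix A B X' Y' and r :: nat
    assume H: "A \<subseteq> verts Z" "\<And>i. i < r \<Longrightarrow> B i \<subseteq> verts Z \<and> A \<inter> B i = {}" "msa_ext L X' Y'"
      "\<And>i. i < r \<Longrightarrow> of_form L Z A (B i) X' Y'"
    have "r = 0"
    proof (rule ccontr)
      assume "r \<noteq> 0"
      hence "B 0 \<subseteq> verts Z" "A \<inter> B 0 = {}" "of_form L Z A (B 0) X' Y'"
        using H(2)[of 0] H(4)[of 0] by auto
      thus False using none[of X' Y' A "B 0"] H(1,3) finX by (simp add: Z_def)
    qed
    thus "r \<le> \<mu> X' Y' (g L Z A)" by simp
  qed
  interpret free_amalgam L X Y Z
    using ext wf finX msa_extD(2)[OF ext] discrete
    by unfold_locales (auto simp: Z_def induced_eq_def occurrences_def)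
  have "\<not> has_disjoint_copies L Z (\<mu> X Y (g L Z X)) X Y"
  proof
    assume "has_disjoint_copies L Z (\<mu> X Y (g L Z X)) X Y"
    then obtain B where B: "\<forall>i<\<mu> X Y (g L Z X). B i \<subseteq> verts Z \<and> X \<inter> B i = {} \<and> of_form L Z X (B i) X Y"
      unfolding has_disjoint_copies_def by (elim exE conjE)
    have "k \<le> \<mu> X Y (g L Z X)"
      using perm ext unfolding permissive_def by simp
    hence "0 < \<mu> X Y (g L Z X)" using \<open>0 < k\<close> by linarith
    with B have "B 0 \<subseteq> verts Z" "X \<inter> B 0 = {}" "of_form L Z X (B 0) X Y" by simp_all
    thus False using none[of X Y X "B 0"] ext finX by (simp add: Z_def)
  qed
  moreover have "free_join Y Z \<in> C_mu L \<mu> \<or> has_disjoint_copies L Z (\<mu> X Y (g L Z X)) X Y"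
    by (rule join_in_C_mu_or_copies[OF _ mult perm ZC]) (rule deg)
  ultimately show ?thesis unfolding join by simp
qed

section \<open>Cyclic extensions\<close>

text \<open>
  The new vertices \<open>0, \<dots>, n - 1\<close> form a cycle, and the \<open>i\<close>-th edge joins \<open>i\<close> to its successor and
  to one more vertex. For \<open>i < k\<close> this is the base vertex \<open>n + i\<close>, which puts every base vertex on
  an edge; for the other edges it is the second successor of \<open>i\<close>.
\<close>

definition cyclic_edge :: "nat \<Rightarrow> nat \<Rightarrow> nat \<Rightarrow> nat set" where
  "cyclic_edge k n i = {i, Suc i mod n, if i < k then n + i else Suc (Suc i) mod n}"

definition cyclic_base :: "nat \<Rightarrow> nat \<Rightarrow> nat set" where
  "cyclic_base k n = {n..<n + k}"

definition cyclic_ext :: "nat \<Rightarrow> nat \<Rightarrow> nat \<Rightarrow> struct" where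
  "cyclic_ext R k n =
     \<lparr>verts = {..<n + k}, rels = (\<lambda>Q. if Q = R then cyclic_edge k n ` {..<n} else {})\<rparr>"

lemma mod_Suc_cyclic: "i < n \<Longrightarrow> Suc i mod n = (if Suc i = n then 0 else Suc i)"
  by auto

lemma mod_Suc_Suc_cyclic:
  "i < n \<Longrightarrow> 2 \<le> n \<Longrightarrow> Suc (Suc i) mod n = (if Suc (Suc i) < n then Suc (Suc i) else Suc (Suc i) - n)"
  by (auto simp: le_mod_geq)

lemma successor_closed_eq_lessThan:
  assumes "U \<subseteq> {..<n}" "U \<noteq> {}" and closed: "\<And>i. i \<in> U \<Longrightarrow> Suc i mod n \<in> U"
  shows "U = {..<n}"
proof -
  obtain u where u: "u \<in> U" "u < n" using assms(1,2) by blast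
  have step: "(u + j) mod n \<in> U" for j
  proof (induction j)
    case 0 thus ?case using u by simp
  next
    case (Suc j)
    thus ?case using closed[OF Suc] by (simp add: mod_Suc_eq)
  qed
  have "w \<in> U" if "w < n" for w
    using step[of "w + n - u"] u that by (simp add: mod_if)
  thus ?thesis using assms(1) by blast
qed

text \<open>
  With \<open>n \<ge> 5\<close> a vertex within two steps after \<open>i\<close> is not within two steps before \<open>i\<close>, so that
  the edges are distinct; \<open>k \<le> n\<close> provides one edge for each base vertex.
\<close>

locale cyclic =
  fixes L :: language and R k n :: nat
  assumes R: "R \<in> symbols L" "arity L R = 3" and kn: "k \<le> n" and n5: "5 \<le> n"
begin

abbreviation "X \<equiv> cyclic_base k n"
abbreviation "Y \<equiv> cyclic_ext R k n"
abbreviation "edge \<equiv> cyclic_edge k n"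

lemma verts_simp: "verts Y = {..<n + k}" by (simp add: cyclic_ext_def)

lemma rels_simp: "rels Y Q = (if Q = R then edge ` {..<n} else {})" by (simp add: cyclic_ext_def)

lemma outside: "verts Y - X = {..<n}" by (auto simp: verts_simp cyclic_base_def)

lemma edge_subset: "i < n \<Longrightarrow> edge i \<subseteq> {..<n + k}"
  using n5 by (auto simp: cyclic_edge_def trans_less_add1)

lemma card_edge: "i < n \<Longrightarrow> card (edge i) = 3"
  using n5 by (auto simp: cyclic_edge_def mod_Suc_cyclic mod_Suc_Suc_cyclic card_insert_if)

lemma mem_edge:
  assumes "w \<in> edge i" "w < n" "i < n"
  shows "w = i \<or> w = Suc i \<or> w = Suc (Suc i) \<or> w + n = Suc i \<or> w + n = Suc (Suc i)"
proof -
  have "w = i \<or> w = Suc i mod n \<or> w = Suc (Suc i) mod n"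
    using assms by (auto simp: cyclic_edge_def split: if_splits)
  moreover have "Suc i mod n = Suc i \<or> Suc i mod n + n = Suc i"
    using mod_Suc_cyclic[OF assms(3)] by auto
  moreover have "Suc (Suc i) mod n = Suc (Suc i) \<or> Suc (Suc i) mod n + n = Suc (Suc i)"
    using mod_Suc_Suc_cyclic[OF assms(3)] n5 by auto
  ultimately show ?thesis by metis
qed

lemma inj_edge: "inj_on edge {..<n}"
proof (rule inj_onI)
  fix i j assume ij: "i \<in> {..<n}" "j \<in> {..<n}" "edge i = edge j"
  have "i \<in> edge i" "j \<in> edge j" by (simp_all add: cyclic_edge_def)
  hence mem: "i \<in> edge j" "j \<in> edge i" using ij(3) by simp_all
  have "i < n" "j < n" using ij(1,2) by simp_all
  with mem_edge[OF mem(1)] mem_edge[OF mem(2)] n5 show "i = j" by linarith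
qed

lemma wf: "wf_struct L Y"
  unfolding wf_struct_def
proof (intro conjI allI impI ballI)
  fix Q e assume "e \<in> rels Y Q"
  then obtain i where "Q = R" "i < n" "e = edge i" by (auto simp: rels_simp split: if_splits)
  thus "Q \<in> symbols L" "e \<subseteq> verts Y" "finite e" "card e = arity L Q"
    using R edge_subset card_edge by (auto simp: verts_simp cyclic_edge_def)
next
  fix A
  have "(SIGMA Q:symbols L. occurrences Y Q A) \<subseteq> {R} \<times> edge ` {..<n}"
    by (auto simp: occurrences_def rels_simp split: if_splits)
  thus "finite (SIGMA Q:symbols L. occurrences Y Q A)"
    by (rule finite_subset) auto
qed

lemma new_edges_cyclic:
  "new_edges (symbols L) Y U X = (\<lambda>i. (R, edge i)) ` {i. i < n \<and> edge i \<subseteq> X \<union> U}"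
proof -
  have "\<not> edge i \<subseteq> X" if "i < n" for i using that by (auto simp: cyclic_edge_def cyclic_base_def)
  thus ?thesis using R(1) by (auto simp: new_edges_def rels_simp split: if_splits)
qed

lemma card_new_edges_cyclic:
  "card (new_edges (symbols L) Y U X) = card {i. i < n \<and> edge i \<subseteq> X \<union> U}"
  unfolding new_edges_cyclic
  by (rule card_image) (use inj_edge in \<open>auto simp: inj_on_def\<close>)

text \<open>
  Charge the \<open>i\<close>-th edge to the vertex \<open>i\<close>. The edges within a set \<open>U\<close> of new vertices are charged to
  vertices whose successor is in \<open>U\<close> too, and unless \<open>U\<close> is the whole cycle, some vertex of \<open>U\<close>
  has its successor outside.
\<close>

lemma simply_algebraic_cyclic: "simply_algebraic L Y {..<n} X"
  unfolding simply_algebraic_iff[OF wf]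
proof (intro conjI allI impI)
  have "edge i \<subseteq> X \<union> {..<n}" if "i < n" for i
    using edge_subset[OF that] by (auto simp: cyclic_base_def)
  hence "{i. i < n \<and> edge i \<subseteq> X \<union> {..<n}} = {..<n}" by auto
  thus "card (new_edges (symbols L) Y {..<n} X) = card {..<n}"
    by (simp add: card_new_edges_cyclic)
  fix U assume U: "U \<subset> {..<n} \<and> U \<noteq> {}"
  let ?I = "{i. i < n \<and> edge i \<subseteq> X \<union> U}"
  have mem: "i \<in> U \<and> Suc i mod n \<in> U" if "i \<in> ?I" for i
  proof -
    have "i \<notin> X" "Suc i mod n \<notin> X" using that n5 by (auto simp: cyclic_base_def not_le)
    thus ?thesis using that unfolding cyclic_edge_def by blast
  qed
  obtain i where "i \<in> U" "Suc i mod n \<notin> U"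
    using successor_closed_eq_lessThan[of U n] U by blast
  hence "?I \<subset> U" using mem by blast
  hence "card ?I < card U"
    using U by (intro psubset_card_mono) (auto intro: finite_subset)
  thus "card (new_edges (symbols L) Y U X) < card U" by (simp add: card_new_edges_cyclic)
qed (use n5 in \<open>auto simp: cyclic_base_def verts_simp lessThan_empty_iff\<close>)

lemma msa: "msa_ext L X Y"
  unfolding msa_ext_def min_simply_algebraic_iff[OF wf] outside
proof (intro conjI wf simply_algebraic_cyclic ballI)
  show "X \<subseteq> verts Y" by (auto simp: cyclic_base_def verts_simp)
  fix x assume "x \<in> X"
  then obtain i where i: "i < k" "x = n + i" by (auto simp: cyclic_base_def le_iff_add)
  moreover from this have "i < n" "edge i \<subseteq> X \<union> {..<n}"
    using kn edge_subset[of i] by (auto simp: cyclic_base_def)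
  ultimately have "(R, edge i) \<in> new_edges (symbols L) Y {..<n} X"
    unfolding new_edges_cyclic by (intro imageI) simp
  moreover have "x \<in> edge i" using i by (simp add: cyclic_edge_def)
  ultimately show "\<exists>Q e. (Q, e) \<in> new_edges (symbols L) Y {..<n} X \<and> x \<in> e" by blast
qed

lemma degree_le_3:
  assumes "w \<in> verts Y - X"
  shows "card (edges_at (symbols L) Y w) \<le> 3"
proof -
  have w: "w < n" using assms outside by blast
  \<comment> \<open>the predecessor and the second predecessor on the cycle\<close>
  define p1 p2 where "p1 = (if w = 0 then n - 1 else w - 1)"
    and "p2 = (if w < 2 then w + n - 2 else w - 2)"
  have "i \<in> {w, p1, p2}" if "i < n" "w \<in> edge i" for i
    using mem_edge[OF that(2) w that(1)] that(1) by (auto simp: p1_def p2_def)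
  hence "{i. i < n \<and> w \<in> edge i} \<subseteq> {w, p1, p2}" by blast
  moreover have "edges_at (symbols L) Y w = (\<lambda>i. (R, edge i)) ` {i. i < n \<and> w \<in> edge i}"
    using R(1) by (auto simp: edges_at_def rels_simp split: if_splits)
  ultimately have "edges_at (symbols L) Y w \<subseteq> (\<lambda>i. (R, edge i)) ` {w, p1, p2}"
    by (simp only: image_mono)
  hence "card (edges_at (symbols L) Y w) \<le> card ((\<lambda>i. (R, edge i)) ` {w, p1, p2})"
    by (intro card_mono) auto
  also have "\<dots> \<le> card {w, p1, p2}" by (intro card_image_le) auto
  also have "\<dots> \<le> 3" by (simp add: card_insert_if)
  finally show ?thesis .
qed

lemma discrete: "occurrences Y Q X = {}"
  by (auto simp: occurrences_def rels_simp cyclic_edge_def cyclic_base_def split: if_splits)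

end

section \<open>Recursiveness\<close>

text \<open>
  \<open>recfn n\<close> speaks of functions on lists of all lengths; only the values at lists of length \<open>n\<close>
  are meaningful, and closure properties become usable once equality elsewhere is not demanded.
\<close>

definition total_recursive :: "nat \<Rightarrow> (nat list \<Rightarrow> nat) \<Rightarrow> bool" where
  "total_recursive n f \<longleftrightarrow> (\<exists>h. recfn n h \<and> (\<forall>xs. length xs = n \<longrightarrow> h xs = f xs))"

lemma total_recursiveI: "recfn n f \<Longrightarrow> total_recursive n f"
  unfolding total_recursive_def by blast

lemma total_recursive_cong:
  assumes "total_recursive n f" "\<And>xs. length xs = n \<Longrightarrow> f xs = f' xs"
  shows "total_recursive n f'"
  using assms unfolding total_recursive_def by metis

lemma total_recursive_comp:
  assumes f: "total_recursive (length gs) f" and gs: "\<And>h. h \<in> set gs \<Longrightarrow> total_recursive n h"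
  shows "total_recursive n (\<lambda>xs. f (map (\<lambda>h. h xs) gs))"
proof -
  obtain f' where f': "recfn (length gs) f'" "\<And>xs. length xs = length gs \<Longrightarrow> f' xs = f xs"
    using f unfolding total_recursive_def by blast
  obtain c where c: "\<And>h. h \<in> set gs \<Longrightarrow> recfn n (c h)"
      "\<And>h xs. h \<in> set gs \<Longrightarrow> length xs = n \<Longrightarrow> c h xs = h xs"
    using gs unfolding total_recursive_def by metis
  have "recfn n (\<lambda>xs. f' (map (\<lambda>h. h xs) (map c gs)))"
    using f'(1) c(1) by (intro recfn.comp) auto
  moreover have "f' (map (\<lambda>h. h xs) (map c gs)) = f (map (\<lambda>h. h xs) gs)" if "length xs = n" for xs
  proof -
    have "map (\<lambda>h. h xs) (map c gs) = map (\<lambda>h. h xs) gs" using c(2) that by simp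
    thus ?thesis using f'(2)[of "map (\<lambda>h. h xs) gs"] by (simp only: length_map)
  qed
  ultimately show ?thesis unfolding total_recursive_def by blast
qed

lemma total_recursive_nth: "i < n \<Longrightarrow> total_recursive n (\<lambda>xs. xs ! i)"
  by (intro total_recursiveI recfn.proj)

lemma total_recursive_comp1:
  assumes "total_recursive 1 (\<lambda>xs. F (xs ! 0))" "total_recursive n a"
  shows "total_recursive n (\<lambda>xs. F (a xs))"
  using total_recursive_comp[of "[a]" "\<lambda>xs. F (xs ! 0)" n] assms by simp

lemma total_recursive_Suc: "total_recursive n a \<Longrightarrow> total_recursive n (\<lambda>xs. Suc (a xs))"
  by (rule total_recursive_comp1[OF total_recursiveI[OF recfn.succ]])

lemma total_recursive_const: "total_recursive n (\<lambda>_. c)"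
  by (induction c) (auto intro: total_recursiveI recfn.zero total_recursive_Suc)

text \<open>
  Kleene's scheme recurses on the first entry of the list; composing it with the projections
  allows the recursion bound to be any recursive function of the parameters \<open>xs\<close>.
\<close>

lemma total_recursive_rec:
  assumes a: "total_recursive n a" and f: "total_recursive n f"
    and h: "total_recursive (Suc (Suc n)) h"
  shows "total_recursive n (\<lambda>xs. rec_nat (f xs) (\<lambda>m r. h (m # r # xs)) (a xs))"
proof -
  obtain f' where f': "recfn n f'" "\<And>xs. length xs = n \<Longrightarrow> f' xs = f xs"
    using f unfolding total_recursive_def by blast
  obtain h' where h': "recfn (Suc (Suc n)) h'" "\<And>xs. length xs = Suc (Suc n) \<Longrightarrow> h' xs = h xs"
    using h unfolding total_recursive_def by blast
  let ?F = "\<lambda>xs. rec_nat (f' (tl xs)) (\<lambda>m r. h' (m # r # tl xs)) (hd xs)"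
  let ?gs = "a # map (\<lambda>i xs. xs ! i) [0..<n]"
  have "total_recursive (length ?gs) ?F"
    using recfn.prec[OF f'(1) h'(1)] by (simp add: total_recursiveI)
  hence "total_recursive n (\<lambda>xs. ?F (map (\<lambda>h. h xs) ?gs))"
    by (rule total_recursive_comp) (use a in \<open>auto intro: total_recursive_nth\<close>)
  thus ?thesis
  proof (rule total_recursive_cong)
    fix xs :: "nat list" assume len: "length xs = n"
    have "map (\<lambda>h. h xs) ?gs = a xs # xs"
      using len map_nth[of xs] by (simp add: comp_def)
    thus "?F (map (\<lambda>h. h xs) ?gs) = rec_nat (f xs) (\<lambda>m r. h (m # r # xs)) (a xs)"
      using len f'(2) h'(2) by simp
  qed
qed

lemma total_recursive_weaken:
  assumes "total_recursive n b"
  shows "total_recursive (Suc (Suc n)) (\<lambda>ys. b (drop 2 ys))"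
    and "total_recursive (Suc n) F \<Longrightarrow> total_recursive (Suc (Suc n)) (\<lambda>ys. F (ys ! 0 # drop 2 ys))"
proof -
  let ?gs = "map (\<lambda>i xs. xs ! (2 + i)) [0..<n]"
  have drop: "map (\<lambda>h. h ys) ?gs = drop 2 ys" if "length ys = Suc (Suc n)" for ys :: "nat list"
    using that by (intro nth_equalityI) auto
  have "total_recursive (Suc (Suc n)) (\<lambda>ys. b (map (\<lambda>h. h ys) ?gs))"
    using assms by (intro total_recursive_comp) (auto intro!: total_recursive_nth)
  thus "total_recursive (Suc (Suc n)) (\<lambda>ys. b (drop 2 ys))"
    by (rule total_recursive_cong) (simp only: drop)
  assume F: "total_recursive (Suc n) F"
  have "total_recursive (Suc (Suc n)) (\<lambda>ys. F (map (\<lambda>h. h ys) ((\<lambda>xs. xs ! 0) # ?gs)))"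
    using F by (intro total_recursive_comp) (auto intro!: total_recursive_nth)
  thus "total_recursive (Suc (Suc n)) (\<lambda>ys. F (ys ! 0 # drop 2 ys))"
    by (rule total_recursive_cong) (simp only: drop list.map)
qed

text \<open>
  The form in which elementary arithmetic is defined: the step depends on the parameters only
  through the value of \<open>c\<close>.
\<close>

lemma total_recursive_prim_rec:
  assumes a: "total_recursive n a" and b: "total_recursive n b" and c: "total_recursive n c"
    and h: "\<And>m u v w. total_recursive m u \<Longrightarrow> total_recursive m v \<Longrightarrow> total_recursive m w \<Longrightarrow>
      total_recursive m (\<lambda>xs. h (u xs) (v xs) (w xs))"
  shows "total_recursive n (\<lambda>xs. rec_nat (b xs) (\<lambda>m r. h m r (c xs)) (a xs))"
proof -
  have "total_recursive (Suc (Suc n)) (\<lambda>ys. h (ys ! 0) (ys ! 1) (c (drop 2 ys)))"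
    by (intro h total_recursive_nth total_recursive_weaken c) auto
  from total_recursive_rec[OF a b this] show ?thesis by simp
qed

lemma total_recursive_add:
  assumes "total_recursive n a" "total_recursive n b"
  shows "total_recursive n (\<lambda>xs. a xs + b xs)"
proof -
  have "rec_nat y (\<lambda>m r. Suc r) x = x + y" for x y :: nat by (induction x) auto
  with total_recursive_prim_rec[OF assms(1,2,2), of "\<lambda>m r _. Suc r"] show ?thesis by (simp add: total_recursive_Suc)
qed

lemma total_recursive_mult:
  assumes "total_recursive n a" "total_recursive n b"
  shows "total_recursive n (\<lambda>xs. a xs * b xs)"
proof -
  have "rec_nat 0 (\<lambda>m r. r + y) x = x * y" for x y :: nat by (induction x) auto
  with total_recursive_prim_rec[OF assms(1) total_recursive_const assms(2), of "\<lambda>m r y. r + y" 0] show ?thesis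
    by (simp add: total_recursive_add)
qed

lemma total_recursive_power:
  assumes "total_recursive n a" "total_recursive n b"
  shows "total_recursive n (\<lambda>xs. b xs ^ a xs)"
proof -
  have "rec_nat 1 (\<lambda>m r. r * y) x = y ^ x" for x y :: nat by (induction x) auto
  with total_recursive_prim_rec[OF assms(1) total_recursive_const assms(2), of "\<lambda>m r y. r * y" 1] show ?thesis
    by (simp add: total_recursive_mult)
qed

lemma total_recursive_diff:
  assumes "total_recursive n a" "total_recursive n b"
  shows "total_recursive n (\<lambda>xs. b xs - a xs)"
proof -
  have pred: "total_recursive m (\<lambda>xs. u xs - 1)" if "total_recursive m u" for m u
  proof -
    have "rec_nat 0 (\<lambda>m r. m) x = x - 1" for x :: nat by (cases x) auto
    with total_recursive_prim_rec[OF that total_recursive_const total_recursive_const, of "\<lambda>m r _. m" 0 0] show ?thesis by simp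
  qed
  have "rec_nat y (\<lambda>m r. r - 1) x = y - x" for x y :: nat by (induction x) auto
  with total_recursive_prim_rec[OF assms(1,2,2), of "\<lambda>m r _. r - 1"] pred show ?thesis by simp
qed

lemma total_recursive_if_less:
  assumes "total_recursive n u" "total_recursive n v" "total_recursive n a" "total_recursive n b"
  shows "total_recursive n (\<lambda>xs. if u xs < v xs then a xs else b xs)"
proof -
  have "total_recursive n (\<lambda>xs. (1 - (Suc (u xs) - v xs)) * a xs
      + (1 - (1 - (Suc (u xs) - v xs))) * b xs)"
    by (intro total_recursive_add total_recursive_mult total_recursive_diff total_recursive_const total_recursive_Suc assms)
  thus ?thesis by (rule total_recursive_cong) (auto simp: Suc_diff_le)
qed

lemma total_recursive_mod:
  assumes "total_recursive n a" "total_recursive n b"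
  shows "total_recursive n (\<lambda>xs. a xs mod b xs)"
proof -
  have "rec_nat 0 (\<lambda>m r. if Suc r < y then Suc r else if y < Suc r then Suc r else 0) x = x mod y"
    for x y :: nat by (induction x) (auto simp: mod_Suc)
  with total_recursive_prim_rec[OF assms(1) total_recursive_const assms(2),
      of "\<lambda>m r y. if Suc r < y then Suc r else if y < Suc r then Suc r else 0" 0]
  show ?thesis by (simp add: total_recursive_if_less total_recursive_Suc total_recursive_const)
qed

lemma total_recursive_prod_encode:
  assumes "total_recursive n a" "total_recursive n b"
  shows "total_recursive n (\<lambda>xs. prod_encode (a xs, b xs))"
proof -
  have "rec_nat 0 (\<lambda>m r. r + Suc m) x = triangle x" for x :: nat by (induction x) auto
  with total_recursive_prim_rec[OF total_recursive_add[OF assms] total_recursive_const total_recursive_const, of "\<lambda>m r _. r + Suc m" 0 0]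
  have "total_recursive n (\<lambda>xs. triangle (a xs + b xs))" by (simp add: total_recursive_add total_recursive_Suc)
  from total_recursive_add[OF this assms(1)] show ?thesis by (simp add: prod_encode_def)
qed

lemma total_recursive_sum:
  assumes a: "total_recursive n a" and F: "total_recursive (Suc n) F"
  shows "total_recursive n (\<lambda>xs. \<Sum>i<a xs. F (i # xs))"
proof -
  have "total_recursive (Suc (Suc n)) (\<lambda>ys. ys ! 1 + F (ys ! 0 # drop 2 ys))"
    by (intro total_recursive_add total_recursive_nth total_recursive_weaken(2)[OF a F]) auto
  moreover have "rec_nat 0 (\<lambda>m r. r + F (m # xs)) x = (\<Sum>i<x. F (i # xs))" for xs x
    by (induction x) auto
  ultimately show ?thesis
    using total_recursive_rec[OF a total_recursive_const, of "\<lambda>ys. ys ! 1 + F (ys ! 0 # drop 2 ys)" 0] by simp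
qed

lemmas total_recursive_intros = total_recursive_const total_recursive_nth total_recursive_Suc total_recursive_add total_recursive_mult total_recursive_power total_recursive_mod total_recursive_if_less total_recursive_prod_encode total_recursive_sum

lemma set_encode_edge:
  assumes "i < n" "3 \<le> n"
  shows "set_encode (cyclic_edge k n i)
    = 2 ^ i + 2 ^ (Suc i mod n) + 2 ^ (if i < k then n + i else Suc (Suc i) mod n)"
proof -
  have "i \<noteq> Suc i mod n" "(if i < k then n + i else Suc (Suc i) mod n) \<notin> {i, Suc i mod n}"
    using assms by (auto simp: mod_Suc_cyclic mod_Suc_Suc_cyclic)
  thus ?thesis unfolding cyclic_edge_def set_encode_def by (auto simp: insert_commute)
qed

text \<open>
  Since the edges are distinct, the codes of finite sets are sums of powers of two over index
  ranges, hence values of a recursive function of \<open>k\<close> and \<open>n\<close>.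
\<close>

lemma ext_code_cyclic:
  assumes kn: "k \<le> n" and n5: "5 \<le> n"
  shows "ext_code (cyclic_base k n) (cyclic_ext R k n) =
    prod_encode (\<Sum>i<k. 2 ^ (n + i), prod_encode (\<Sum>i<n + k. 2 ^ i,
      \<Sum>i<n. 2 ^ prod_encode (R, 2 ^ i + 2 ^ (Suc i mod n)
        + 2 ^ (if i < k then n + i else Suc (Suc i) mod n))))"
proof -
  interpret cyclic "\<lparr>symbols = {R}, arity = \<lambda>_. 3\<rparr>" R k n
    using assms by unfold_locales auto
  have "{prod_encode (Q, set_encode e) |Q e. e \<in> rels (cyclic_ext R k n) Q}
      = (\<lambda>i. prod_encode (R, set_encode (edge i))) ` {..<n}"
    by (auto simp: rels_simp split: if_splits)
  moreover have "inj_on (\<lambda>i. prod_encode (R, set_encode (edge i))) {..<n}"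
  proof (rule inj_onI)
    fix i j assume ij: "i \<in> {..<n}" "j \<in> {..<n}"
      and "prod_encode (R, set_encode (edge i)) = prod_encode (R, set_encode (edge j))"
    hence "set_encode (edge i) = set_encode (edge j)" by simp
    moreover have "finite (edge i)" "finite (edge j)" by (auto simp: cyclic_edge_def)
    ultimately have "edge i = edge j" by (simp add: set_encode_eq)
    thus "i = j" using inj_edge ij by (auto simp: inj_on_def)
  qed
  ultimately have "set_encode {prod_encode (Q, set_encode e) |Q e. e \<in> rels (cyclic_ext R k n) Q}
      = (\<Sum>i<n. 2 ^ prod_encode (R, set_encode (edge i)))"
    by (simp add: set_encode_def sum.reindex)
  also have "\<dots> = (\<Sum>i<n. 2 ^ prod_encode (R, 2 ^ i + 2 ^ (Suc i mod n)
        + 2 ^ (if i < k then n + i else Suc (Suc i) mod n)))"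
    using n5 by (intro sum.cong) (auto simp: set_encode_edge)
  finally have 1: "set_encode {prod_encode (Q, set_encode e) |Q e. e \<in> rels (cyclic_ext R k n) Q}
      = \<dots>" .
  have "set_encode {n..<n + k} = (\<Sum>i<k. 2 ^ (n + i))"
    using sum.shift_bounds_nat_ivl[of "\<lambda>i. 2 ^ i :: nat" 0 n k]
    by (simp add: set_encode_def lessThan_atLeast0 add.commute)
  thus ?thesis unfolding ext_code_def 1 by (simp add: verts_simp set_encode_def cyclic_base_def)
qed

lemma recursive_cyclic:
  "recursive_sequence (\<lambda>k l. cyclic_base k (k + l + 5)) (\<lambda>k l. cyclic_ext R k (k + l + 5))"
proof -
  let ?N = "\<lambda>xs :: nat list. xs ! 0 + xs ! 1 + 5"
  let ?N' = "\<lambda>ys :: nat list. ys ! 1 + ys ! 2 + 5"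
  let ?F = "\<lambda>xs. prod_encode (\<Sum>i<xs ! 0. (\<lambda>ys. 2 ^ (?N' ys + ys ! 0)) (i # xs),
    prod_encode (\<Sum>i<?N xs + xs ! 0. (\<lambda>ys. 2 ^ (ys ! 0)) (i # xs),
      \<Sum>i<?N xs. (\<lambda>ys. 2 ^ prod_encode (R, 2 ^ (ys ! 0) + 2 ^ (Suc (ys ! 0) mod ?N' ys)
        + 2 ^ (if ys ! 0 < ys ! 1 then ?N' ys + ys ! 0 else Suc (Suc (ys ! 0)) mod ?N' ys))) (i # xs)))"
  have "total_recursive 2 ?F"
    by (intro total_recursive_prod_encode total_recursive_sum; intro total_recursive_intros; simp)
  then obtain f where "recfn 2 f" and f: "\<And>xs. length xs = 2 \<Longrightarrow> f xs = ?F xs"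
    unfolding total_recursive_def by blast
  moreover have "f [k, l] = ext_code (cyclic_base k (k + l + 5)) (cyclic_ext R k (k + l + 5))" for k l
    by (subst f) (simp_all add: ext_code_cyclic cong: if_cong)
  ultimately show ?thesis unfolding recursive_sequence_def by blast
qed

section \<open>Infinitely many unblockable extensions of each base size\<close>

theorem corollary3p18:
  fixes L :: language and R :: nat
  assumes "wf_language L" and "R \<in> symbols L" and "arity L R = 3"
  shows "\<exists>(X :: nat \<Rightarrow> nat \<Rightarrow> nat set) (Y :: nat \<Rightarrow> nat \<Rightarrow> struct).
           recursive_sequence X Y \<and>
           (\<forall>k l. unblockable L R 3 (X k l) (Y k l) \<and> card (X k l) = k) \<and>
           (\<forall>k l l'. l \<noteq> l' \<longrightarrow> \<not> ext_iso L (X k l) (Y k l) (X k l') (Y k l')) \<and>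
           (\<forall>\<mu>. mult_function L R \<mu> \<and> permissive L 3 \<mu> \<longrightarrow> (\<forall>k l. Y k l \<in> C_mu L \<mu>))"
proof (intro exI conjI allI impI)
  let ?X = "\<lambda>k l. cyclic_base k (k + l + 5)" and ?Y = "\<lambda>k l. cyclic_ext R k (k + l + 5)"
  have cyc: "cyclic L R k (k + l + 5)" for k l using assms(2,3) by unfold_locales auto
  show "recursive_sequence ?X ?Y" by (rule recursive_cyclic)
  fix k l
  interpret cyclic L R k "k + l + 5" by (rule cyc)
  show "unblockable L R 3 (?X k l) (?Y k l)"
    by (rule unblockable_of_degree_le[OF msa degree_le_3])
  show "card (?X k l) = k" by (simp add: cyclic_base_def)
  show "?Y k l \<in> C_mu L \<mu>" if "mult_function L R \<mu> \<and> permissive L 3 \<mu>" for \<mu>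
    using that discrete by (intro extension_of_discrete_in_C_mu[OF msa degree_le_3]) auto
  show "\<not> ext_iso L (?X k l) (?Y k l) (?X k l') (?Y k l')" if "l \<noteq> l'" for l'
  proof
    assume "ext_iso L (?X k l) (?Y k l) (?X k l') (?Y k l')"
    then obtain f where "bij_betw f (verts (?Y k l)) (verts (?Y k l'))"
      unfolding ext_iso_def by blast
    hence "card (verts (?Y k l)) = card (verts (?Y k l'))" by (rule bij_betw_same_card)
    thus False using that by (simp add: cyclic_ext_def)
  qed
qed

end
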